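(* Let $\alpha$ be a positive number, let $\nu_\alpha$ be the free Gamma distribution with parameter $\alpha$, and let $c_\alpha$, $v_\alpha$, $P_\alpha$, $s_\alpha$ be as defined in the context. Consider the function $Q_\alpha\colon\mathbb{R}\to[0,\infty)$ defined by \[ Q_\alpha(x)=\frac{v_\alpha(x)}{x^2+v_\alpha(x)^2},\qquad x\in\mathbb{R}. \] Then: (i) $\nu_\alpha$ is absolutely continuous with respect to Lebesgue measure. (ii) The density $f_\alpha$ of $\nu_\alpha$ is given by \[ f_\alpha(\xi)=\begin{cases}0,&\text{if }\xi\in(-\infty,s_\alpha],\\ \frac1\pi Q_\alpha\big(P_\alpha^{\langle-1\rangle}(\xi)\big),&\text{if }\xi\in(s_\alpha,\infty),\end{cases} \] where $P_\alpha^{\langle-1\rangle}$ denotes the inverse of $P_\alpha$. (iii) The support of $\nu_\alpha$ is $[s_\alpha,\infty)$. (iv) $f_\alpha$ is analytic on $(s_\alpha,\infty)$.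
   Context: Free Gamma distribution. For $\alpha>0$ let $\mu_\alpha$ be the classical Gamma distribution, $\mu_\alpha(B)=\frac1{\Gamma(\alpha)}\int_{B\cap[0,\infty)}t^{\alpha-1}e^{-t}\,dt$. A probability measure $\mu$ on $\mathbb{R}$ is ($*$-)infinitely divisible iff its characteristic function is $\hat\mu(u)=\exp\big[\mathrm{i}\eta u-\frac12au^2+\int_{\mathbb{R}}(e^{\mathrm{i}ut}-1-\mathrm{i}ut1_{[-1,1]}(t))\,\rho(dt)\big]$ with $\eta\in\mathbb{R}$, $a\ge0$ and $\rho$ a Lévy measure ($\rho(\{0\})=0$, $\int\min\{1,t^2\}\,\rho(dt)<\infty$); $(a,\rho,\eta)$ is unique and called the characteristic triplet of $\mu$. The Cauchy transform of $\mu$ is $G_\mu(z)=\int_{\mathbb{R}}\frac{1}{z-t}\,\mu(dt)$, $z\in\mathbb{C}\setminus\mathrm{supp}(\mu)$. The free cumulant transform is $\mathcal{C}_\mu(z)=zG_\mu^{\langle-1\rangle}(z)-1$, defined for $z\in\mathbb{C}^-$ with $1/z\in\Delta_{\eta,M}=\{w\in\mathbb{C}^+: |\mathrm{Re}\,w|<\eta\,\mathrm{Im}\,w,\ \mathrm{Im}\,w>M\}$ for suitable $\eta,M>0$, where the right inverse $G_\mu^{\langle-1\rangle}$ of $G_\mu$ is well-defined. $\mu$ is infinitely divisible with respect to free convolution $\boxplus$ iff $\mathcal{C}_\mu(z)=\eta z+az^2+\int_{\mathbb{R}}\big(\frac{1}{1-tz}-1-tz1_{[-1,1]}(t)\big)\,\rho(dt)$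 for some $a\ge0$, $\eta\in\mathbb{R}$ and Lévy measure $\rho$; then $(a,\rho,\eta)$ is unique and called the free characteristic triplet of $\mu$. The Bercovici–Pata bijection $\Lambda$ sends the $*$-infinitely divisible law with characteristic triplet $(a,\rho,\eta)$ to the $\boxplus$-infinitely divisible law with free characteristic triplet $(a,\rho,\eta)$. The free Gamma distribution with parameter $\alpha$ is $\nu_\alpha=\Lambda(\mu_\alpha)$. Auxiliary functions. For $z\in\mathbb{C}\setminus[0,\infty)$ put $H_\alpha(z)=z+\alpha+\alpha\int_0^\infty\frac{te^{-t}}{z-t}\,dt$ and $F(z)=\int_0^\infty\frac{te^{-t}}{|z-t|^2}\,dt$. $c_\alpha$ is the unique positive number with $F(-c_\alpha)=\frac1\alpha$. $v_\alpha\colon\mathbb{R}\to[0,\infty)$ is given by $v_\alpha(x)=0$ for $x\le-c_\alpha$, and for $x>-c_\alpha$, $v_\alpha(x)$ is the unique $y>0$ with $F(x+\mathrm{i}y)=\frac1\alpha$. Then $H_\alpha(x+\mathrm{i}v_\alpha(x))\in\mathbb{R}$ for all $x\in\mathbb{R}$, and $P_\alpha\colon\mathbb{R}\to\mathbb{R}$ is defined by $P_\alpha(x)=H_\alpha(x+\mathrm{i}v_\alpha(x))$; it is a strictly increasing bijection of $\mathbb{R}$ onto $\mathbb{R}$. Put $s_\alpha=P_\alpha(-c_\alpha)=H_\alpha(-c_\alpha)$. *)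

theory Defs
  imports "HOL-Probability.Probability" "HOL-Complex_Analysis.Complex_Analysis"
begin

section \<open>Classical and free infinite divisibility\<close>

definition gamma_distribution :: "real \<Rightarrow> real measure" where
  "gamma_distribution \<alpha> =
     density lborel (\<lambda>t. ennreal (indicator {0..} t * t powr (\<alpha> - 1) * exp (- t) / Gamma \<alpha>))"

definition levy_measure :: "real measure \<Rightarrow> bool" where
  "levy_measure \<rho> \<longleftrightarrow>
     sets \<rho> = sets borel \<and> emeasure \<rho> {0} = 0 \<and> (\<integral>\<^sup>+ t. ennreal (min 1 (t\<^sup>2)) \<partial>\<rho>) < \<infinity>"

definition has_characteristic_triplet ::
    "real measure \<Rightarrow> real \<Rightarrow> real measure \<Rightarrow> real \<Rightarrow> bool" where
  "has_characteristic_triplet \<mu> a \<rho> \<eta> \<longleftrightarrow>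
     real_distribution \<mu> \<and> a \<ge> 0 \<and> levy_measure \<rho> \<and>
     (\<forall>u::real. char \<mu> u =
        exp (\<i> * of_real \<eta> * of_real u - of_real a * (of_real u)\<^sup>2 / 2 +
             (CLINT t|\<rho>. exp (\<i> * of_real u * of_real t) - 1
                        - \<i> * of_real u * of_real t * indicator {-1..1} t)))"

definition cauchy_transform :: "real measure \<Rightarrow> complex \<Rightarrow> complex" where
  "cauchy_transform \<mu> z = (CLINT t|\<mu>. 1 / (z - of_real t))"

definition truncated_cone :: "real \<Rightarrow> real \<Rightarrow> complex set" where
  "truncated_cone \<beta> M = {w. Im w > M \<and> \<bar>Re w\<bar> < \<beta> * Im w}"

definition cumulant_domain :: "real \<Rightarrow> real \<Rightarrow> complex set" where
  "cumulant_domain \<beta> M = {z. Im z < 0 \<and> 1 / z \<in> truncated_cone \<beta> M}"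

text \<open>
  The Cauchy transform need not be injective on the upper half-plane, so the equation
  \<open>G (K z) = z\<close> alone does not single out a right inverse \<open>K\<close>. As in the work of Bercovici and
  Voiculescu, the right inverse is the one with values in a truncated cone near infinity on
  which \<open>G\<close> is injective. Different choices of the cones give functions which agree where
  both are defined.
\<close>

definition cauchy_right_inverse ::
    "real measure \<Rightarrow> real \<Rightarrow> real \<Rightarrow> (complex \<Rightarrow> complex) \<Rightarrow> bool" where
  "cauchy_right_inverse \<mu> \<beta> M K \<longleftrightarrow>
     \<beta> > 0 \<and> M > 0 \<and>
     (\<exists>\<beta>'>0. \<exists>M'>0. inj_on (cauchy_transform \<mu>) (truncated_cone \<beta>' M') \<and>
        (\<forall>z\<in>cumulant_domain \<beta> M. K z \<in> truncated_cone \<beta>' M' \<and> cauchy_transform \<mu> (K z) = z))"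

definition free_cumulant_transform ::
    "real measure \<Rightarrow> real \<Rightarrow> real \<Rightarrow> (complex \<Rightarrow> complex) \<Rightarrow> bool" where
  "free_cumulant_transform \<mu> \<beta> M C \<longleftrightarrow>
     (\<exists>K. cauchy_right_inverse \<mu> \<beta> M K \<and> (\<forall>z\<in>cumulant_domain \<beta> M. C z = z * K z - 1))"

definition has_free_characteristic_triplet ::
    "real measure \<Rightarrow> real \<Rightarrow> real measure \<Rightarrow> real \<Rightarrow> bool" where
  "has_free_characteristic_triplet \<mu> a \<rho> \<eta> \<longleftrightarrow>
     real_distribution \<mu> \<and> a \<ge> 0 \<and> levy_measure \<rho> \<and>
     (\<exists>\<beta> M. free_cumulant_transform \<mu> \<beta> M
        (\<lambda>z. of_real \<eta> * z + of_real a * z\<^sup>2 +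
             (CLINT t|\<rho>. 1 / (1 - of_real t * z) - 1 - of_real t * z * indicator {-1..1} t)))"

text \<open>The graph of the Bercovici--Pata bijection.\<close>

definition bercovici_pata :: "real measure \<Rightarrow> real measure \<Rightarrow> bool" where
  "bercovici_pata \<mu> \<nu> \<longleftrightarrow>
     (\<exists>a \<rho> \<eta>. has_characteristic_triplet \<mu> a \<rho> \<eta> \<and> has_free_characteristic_triplet \<nu> a \<rho> \<eta>)"

definition free_gamma_distribution :: "real \<Rightarrow> real measure \<Rightarrow> bool" where
  "free_gamma_distribution \<alpha> \<nu> \<longleftrightarrow> bercovici_pata (gamma_distribution \<alpha>) \<nu>"


section \<open>Auxiliary functions\<close>

definition H_fun :: "real \<Rightarrow> complex \<Rightarrow> complex" where
  "H_fun \<alpha> z = z + of_real \<alpha> +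
     of_real \<alpha> * (CLINT t:{0..}|lborel. of_real (t * exp (- t)) / (z - of_real t))"

definition F_fun :: "complex \<Rightarrow> real" where
  "F_fun z = (LINT t:{0..}|lborel. t * exp (- t) / (cmod (z - of_real t))\<^sup>2)"

definition c_const :: "real \<Rightarrow> real" where
  "c_const \<alpha> = (THE c. c > 0 \<and> F_fun (of_real (- c)) = 1 / \<alpha>)"

definition v_fun :: "real \<Rightarrow> real \<Rightarrow> real" where
  "v_fun \<alpha> x =
     (if x \<le> - c_const \<alpha> then 0 else (THE y. y > 0 \<and> F_fun (Complex x y) = 1 / \<alpha>))"

text \<open>The value of \<open>H_fun\<close> below is real, so taking the real part loses no information.\<close>

definition P_fun :: "real \<Rightarrow> real \<Rightarrow> real" where
  "P_fun \<alpha> x = Re (H_fun \<alpha> (Complex x (v_fun \<alpha> x)))"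

definition s_const :: "real \<Rightarrow> real" where
  "s_const \<alpha> = P_fun \<alpha> (- c_const \<alpha>)"


section \<open>Densities, supports, real analyticity\<close>

definition is_lebesgue_density :: "real measure \<Rightarrow> (real \<Rightarrow> real) \<Rightarrow> bool" where
  "is_lebesgue_density \<mu> f \<longleftrightarrow>
     f \<in> borel_measurable borel \<and> (\<forall>x. f x \<ge> 0) \<and> \<mu> = density lborel (\<lambda>x. ennreal (f x))"

definition measure_support :: "real measure \<Rightarrow> real set" where
  "measure_support \<mu> = {x. \<forall>U. open U \<and> x \<in> U \<longrightarrow> emeasure \<mu> U > 0}"

definition real_analytic_on :: "(real \<Rightarrow> real) \<Rightarrow> real set \<Rightarrow> bool" where
  "real_analytic_on f S \<longleftrightarrow>
     (\<forall>x\<in>S. \<exists>r>0. \<exists>a::nat \<Rightarrow> real. \<forall>y. \<bar>y - x\<bar> < r \<longrightarrow> (\<lambda>n. a n * (y - x) ^ n) sums f y)"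

end

theory Submission
  imports Defs
begin

text \<open>
  Write \<open>H = H_fun \<alpha>\<close>, and let \<open>G\<close> be the Cauchy transform of the free Gamma distribution \<open>\<nu>\<close>. The
  theorem holds because \<open>G (H w) = 1 / w\<close> and because \<open>H\<close> is a conformal map, with a very
  well-behaved boundary, from an explicit region above the graph of \<open>v_fun \<alpha>\<close> onto the upper
  half-plane.

  The identity for \<open>G\<close> comes from the Levy--Khintchine representations. The free cumulant transform
  at \<open>\<i> y\<close> equals the integral of \<open>\<psi> (y x) exp (- x)\<close> over \<open>x > 0\<close>, where \<open>\<psi>\<close> is the classical
  exponent with the same triplet (\<open>integral_levy_exponent_exponential\<close>). Thus it depends on the
  triplet only through \<open>\<psi>\<close>, and \<open>\<psi>\<close> is the continuous logarithm \<open>- \<alpha> Ln (1 - \<i> u)\<close> of the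
  characteristic function of the Gamma law (\<open>levy_exponent_gamma\<close>). An integration by parts identifies
  the resulting right inverse of \<open>G\<close> with \<open>H (1 / z)\<close>, so that \<open>G (H (\<i> y)) = 1 / (\<i> y)\<close> for large
  \<open>y\<close> (\<open>cauchy_transform_free_gamma\<close>).

  The geometry of \<open>H\<close> rests on two formulas: \<open>Im (H w) = Im w (1 - \<alpha> F w)\<close>, and
  \<open>H w - H z = (w - z) q\<close>, where \<open>q\<close> has positive real part as soon as \<open>F w\<close> and \<open>F z\<close> are at most
  \<open>1 / \<alpha>\<close> and \<open>w\<close>, \<open>z\<close> are not conjugate (\<open>Re_resolvent_pairing_less\<close>). They make \<open>H\<close> injective on the
  closed region, real exactly on its boundary, and increasing along the boundary. Moreover
  \<open>H w - w\<close> is bounded there (\<open>H_fun_near_identity\<close>), so \<open>H\<close> is proper. Therefore \<open>H\<close> is a homeomorphism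
  of the closed region onto the closed upper half-plane, and its inverse \<open>H_inv\<close> is continuous up to
  the real line.

  By the identity theorem \<open>G = 1 / H_inv\<close> on the upper half-plane, so \<open>G\<close> has continuous boundary
  values, and Stieltjes inversion (\<open>stieltjes_inversion\<close>) shows that \<open>\<nu>\<close> has the density
  \<open>- Im (1 / H_inv \<xi>) / \<pi>\<close>. At \<open>\<xi> = P x\<close> this is \<open>Q x / \<pi>\<close>, which is positive precisely for \<open>x > - c\<close>,
  that is, for \<open>\<xi> > s\<close>. Analyticity holds since \<open>H\<close> has non-zero derivative at boundary points off
  the real axis, so that \<open>H_inv\<close> extends holomorphically across the line there.
\<close>

section \<open>Parametric integrals\<close>

text \<open>
  Dominated convergence along sequences; the domination is required only locally, which is what
  integrands with singularities at the edge of the parameter set satisfy.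
\<close>

lemma continuous_on_integral_dominated:
  fixes f :: "'b::metric_space \<Rightarrow> 'a \<Rightarrow> 'c::{banach,second_countable_topology}"
  assumes meas: "\<And>z. z \<in> S \<Longrightarrow> f z \<in> borel_measurable M"
    and cont: "\<And>t. t \<in> space M \<Longrightarrow> continuous_on S (\<lambda>z. f z t)"
    and dom: "\<And>z. z \<in> S \<Longrightarrow> \<exists>r>0. \<exists>g. integrable M g \<and>
                (\<forall>w \<in> ball z r \<inter> S. \<forall>t \<in> space M. norm (f w t) \<le> g t)"
  shows "continuous_on S (\<lambda>z. \<integral>t. f z t \<partial>M)"
proof (rule continuous_on_sequentiallyI)
  fix u a assume u: "\<forall>n. u n \<in> S" "a \<in> S" "u \<longlonglongrightarrow> a"
  obtain r g where r: "r > 0" and g: "integrable M g"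
    and bd: "\<And>w t. w \<in> ball a r \<Longrightarrow> w \<in> S \<Longrightarrow> t \<in> space M \<Longrightarrow> norm (f w t) \<le> g t"
    using dom[OF u(2)] by (metis IntI)
  obtain N where N: "\<And>n. n \<ge> N \<Longrightarrow> u n \<in> ball a r"
    using u(3) r unfolding lim_sequentially by (metis dist_commute mem_ball)
  have "(\<lambda>n. \<integral>t. f (u (n + N)) t \<partial>M) \<longlonglongrightarrow> (\<integral>t. f a t \<partial>M)"
  proof (rule integral_dominated_convergence[where w = g])
    show "AE t in M. (\<lambda>n. f (u (n + N)) t) \<longlonglongrightarrow> f a t"
    proof (rule AE_I2)
      fix t assume "t \<in> space M"
      from cont[OF this] have "(\<lambda>n. f (u n) t) \<longlonglongrightarrow> f a t"
        using u by (auto simp: continuous_on_sequentially o_def)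
      thus "(\<lambda>n. f (u (n + N)) t) \<longlonglongrightarrow> f a t"
        by (rule LIMSEQ_ignore_initial_segment)
    qed
  qed (use u meas g N bd in auto)
  thus "(\<lambda>n. \<integral>t. f (u n) t \<partial>M) \<longlonglongrightarrow> (\<integral>t. f a t \<partial>M)"
    by (rule LIMSEQ_offset)
qed

text \<open>
  Cauchy's inequality turns a local bound on the integrand into a bound on its difference
  quotients by a multiple of the same integrable function, so that dominated convergence gives the
  complex derivative.
\<close>

lemma holomorphic_on_integral_dominated:
  fixes f :: "complex \<Rightarrow> 'a \<Rightarrow> complex"
  assumes S: "open S"
    and meas: "\<And>z. z \<in> S \<Longrightarrow> f z \<in> borel_measurable M"
    and hol: "\<And>t. t \<in> space M \<Longrightarrow> (\<lambda>z. f z t) holomorphic_on S"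
    and dom: "\<And>z. z \<in> S \<Longrightarrow> \<exists>r>0. \<exists>g. integrable M g \<and>
                (\<forall>w \<in> ball z r \<inter> S. \<forall>t \<in> space M. norm (f w t) \<le> g t)"
  shows "(\<lambda>z. \<integral>t. f z t \<partial>M) holomorphic_on S"
  unfolding holomorphic_on_open[OF S]
proof safe
  fix a assume a: "a \<in> S"
  obtain r0 g where r0: "r0 > 0" and g: "integrable M g"
    and bd0: "\<And>w t. w \<in> ball a r0 \<Longrightarrow> w \<in> S \<Longrightarrow> t \<in> space M \<Longrightarrow> norm (f w t) \<le> g t"
    using dom[OF a] by (metis IntI)
  obtain r1 where r1: "r1 > 0" "ball a r1 \<subseteq> S" using S a open_contains_ball by blast
  define r where "r = min r0 r1 / 3"
  have r: "r > 0" using r0 r1 by (simp add: r_def)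
  have near: "w \<in> S \<and> w \<in> ball a r0" if "dist a w \<le> 2 * r" for w
    using that r0 r1 r by (auto simp: r_def subset_iff min_def split: if_splits)
  have int: "integrable M (f w)" if "dist a w \<le> 2 * r" for w
    using near[OF that] g bd0 meas
    by (intro Bochner_Integration.integrable_bound[OF g]) (auto intro!: order.trans[OF bd0])
  define d where "d t = deriv (\<lambda>z. f z t) a" for t
  have lip: "norm (f w t - f a t) \<le> g t / r * norm (w - a)"
    if w: "w \<in> ball a r" and t: "t \<in> space M" for w t
  proof (rule field_differentiable_bound[where S = "ball a r" and f = "\<lambda>z. f z t" and x = w and y = a and f' = "deriv (\<lambda>z. f z t)"])
    fix z assume z: "z \<in> ball a r"
    have sub: "cball z r \<subseteq> {w. dist a w \<le> 2 * r}"
      using z by (auto simp: dist_norm) (smt (verit) dist_norm dist_triangle)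
    have hS: "(\<lambda>z. f z t) holomorphic_on cball z r"
      by (rule holomorphic_on_subset[OF hol[OF t]]) (use sub near in blast)
    have zS: "z \<in> S" using near[of z] z r by simp
    show "((\<lambda>z. f z t) has_field_derivative deriv (\<lambda>z. f z t) z) (at z within ball a r)"
      by (rule has_field_derivative_at_within[OF holomorphic_derivI[OF hol[OF t] S zS]])
    have "norm ((deriv ^^ 1) (\<lambda>z. f z t) z) \<le> fact 1 * g t / r ^ 1"
    proof (rule Cauchy_inequality)
      show "(\<lambda>z. f z t) holomorphic_on ball z r" using hS holomorphic_on_subset ball_subset_cball by blast
      show "continuous_on (cball z r) (\<lambda>z. f z t)" using hS by (rule holomorphic_on_imp_continuous_on)
      fix w assume "norm (z - w) = r"
      hence "dist a w \<le> 2 * r" using sub by (auto simp: dist_norm)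
      thus "norm (f w t) \<le> g t" using near bd0 t by blast
    qed (use r in auto)
    thus "norm (deriv (\<lambda>z. f z t) z) \<le> g t / r" by simp
  qed (use w r in auto)
  have "((\<lambda>z. \<integral>t. f z t \<partial>M) has_field_derivative (\<integral>t. d t \<partial>M)) (at a)"
    unfolding has_field_derivative_iff tendsto_at_iff_sequentially o_def
  proof safe
    fix X assume X: "\<forall>i. X i \<in> UNIV - {a}" "X \<longlonglongrightarrow> a"
    obtain N where N: "\<And>n. n \<ge> N \<Longrightarrow> X n \<in> ball a r"
      using X(2) r unfolding lim_sequentially by (metis dist_commute mem_ball)
    let ?q = "\<lambda>n t. (f (X (n + N)) t - f a t) / (X (n + N) - a)"
    have XN: "dist a (X (n + N)) \<le> 2 * r" for n using N[of "n + N"] r by simp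
    have lim: "(\<lambda>n. ?q n t) \<longlonglongrightarrow> d t" if t: "t \<in> space M" for t
    proof -
      have "((\<lambda>z. f z t) has_field_derivative d t) (at a)"
        unfolding d_def by (rule holomorphic_derivI[OF hol[OF t] S a])
      hence "(\<lambda>n. (f (X n) t - f a t) / (X n - a)) \<longlonglongrightarrow> d t"
        using X unfolding has_field_derivative_iff tendsto_at_iff_sequentially o_def by blast
      thus ?thesis by (rule LIMSEQ_ignore_initial_segment)
    qed
    have qm: "?q n \<in> borel_measurable M" for n
      using int[OF XN] int[of a] r by (intro borel_measurable_divide borel_measurable_diff) auto
    have "(\<lambda>n. \<integral>t. ?q n t \<partial>M) \<longlonglongrightarrow> (\<integral>t. d t \<partial>M)"
    proof (rule integral_dominated_convergence[where w = "\<lambda>t. g t / r"])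
      show "d \<in> borel_measurable M"
        using lim qm by (rule borel_measurable_LIMSEQ_metric[rotated])
      show "AE t in M. norm (?q n t) \<le> g t / r" for n
      proof (rule AE_I2)
        fix t assume "t \<in> space M"
        from lip[OF _ this, of "X (n + N)"] N[of "n + N"] X
        show "norm (?q n t) \<le> g t / r"
          by (simp add: norm_divide divide_simps split: if_splits)
      qed
    qed (use g lim qm in auto)
    also have "(\<lambda>n. \<integral>t. ?q n t \<partial>M) =
        (\<lambda>n. ((\<integral>t. f (X (n + N)) t \<partial>M) - (\<integral>t. f a t \<partial>M)) / (X (n + N) - a))"
      using int[OF XN] int[of a] r by simp
    finally show "(\<lambda>n. ((\<integral>t. f (X n) t \<partial>M) - (\<integral>t. f a t \<partial>M)) / (X n - a)) \<longlonglongrightarrow> (\<integral>t. d t \<partial>M)"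
      by (rule LIMSEQ_offset)
  qed
  thus "\<exists>f'. ((\<lambda>z. \<integral>t. f z t \<partial>M) has_field_derivative f') (at a)" by blast
qed

section \<open>Stieltjes inversion\<close>

lemma integrable_cauchy_kernel:
  assumes "real_distribution \<nu>" "Im z > 0"
  shows "integrable \<nu> (\<lambda>t. 1 / (z - of_real t))"
proof -
  interpret real_distribution \<nu> by fact
  have "cmod (1 / (z - of_real t)) \<le> 1 / Im z" for t
    using abs_Im_le_cmod[of "z - of_real t"] assms(2) by (simp add: norm_divide frac_le)
  thus ?thesis by (intro integrable_const_bound[where B = "1 / Im z"]) auto
qed

text \<open>
  Divided by \<open>\<pi>\<close>, the right-hand side is the convolution of \<open>\<nu>\<close> with the Poisson kernel of
  the upper half-plane.
\<close>

lemma neg_Im_cauchy_transform: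
  assumes "real_distribution \<nu>" "\<epsilon> > 0"
  shows "- Im (cauchy_transform \<nu> (Complex x \<epsilon>)) = (\<integral>t. \<epsilon> / ((x - t)\<^sup>2 + \<epsilon>\<^sup>2) \<partial>\<nu>)"
proof -
  have "Im (cauchy_transform \<nu> (Complex x \<epsilon>)) = (\<integral>t. Im (1 / (Complex x \<epsilon> - of_real t)) \<partial>\<nu>)"
    unfolding cauchy_transform_def
    using assms by (intro integral_Im[symmetric] integrable_cauchy_kernel) auto
  also have "(\<lambda>t. Im (1 / (Complex x \<epsilon> - of_real t))) = (\<lambda>t. - (\<epsilon> / ((x - t)\<^sup>2 + \<epsilon>\<^sup>2)))"
    by (simp add: Im_divide)
  finally show ?thesis by simp
qed

lemma poisson_kernel_integral:
  fixes \<epsilon> :: real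
  assumes "\<epsilon> > 0" "a \<le> b"
  shows "(\<integral>x. \<epsilon> / ((x - t)\<^sup>2 + \<epsilon>\<^sup>2) * indicator {a..b} x \<partial>lborel) =
      arctan ((b - t) / \<epsilon>) - arctan ((a - t) / \<epsilon>)"
proof (rule integral_FTC_Icc_nonneg)
  fix x
  have ne: "\<epsilon>\<^sup>2 + (x - t)\<^sup>2 > 0" using assms by (intro add_pos_nonneg) auto
  show "((\<lambda>x. arctan ((x - t) / \<epsilon>)) has_real_derivative \<epsilon> / ((x - t)\<^sup>2 + \<epsilon>\<^sup>2)) (at x)"
    using assms ne
    by (auto intro!: derivative_eq_intros simp: field_simps power2_eq_square)
  show "0 \<le> \<epsilon> / ((x - t)\<^sup>2 + \<epsilon>\<^sup>2)" using assms by simp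
qed (use assms in auto)

lemma cauchy_transform_interval:
  assumes \<nu>: "real_distribution \<nu>" and \<epsilon>: "\<epsilon> > 0" and ab: "a \<le> b"
  shows "(\<integral>x. - Im (cauchy_transform \<nu> (Complex x \<epsilon>)) * indicator {a..b} x \<partial>lborel) =
      (\<integral>t. arctan ((b - t) / \<epsilon>) - arctan ((a - t) / \<epsilon>) \<partial>\<nu>)"
proof -
  interpret real_distribution \<nu> by fact
  interpret P: pair_sigma_finite lborel \<nu> ..
  let ?k = "\<lambda>x t. \<epsilon> / ((x - t)\<^sup>2 + \<epsilon>\<^sup>2) * indicator {a..b} x :: real"
  have bound: "\<epsilon> / ((x - t)\<^sup>2 + \<epsilon>\<^sup>2) \<le> 1 / \<epsilon>" for x t
  proof -
    have "\<epsilon> / ((x - t)\<^sup>2 + \<epsilon>\<^sup>2) \<le> \<epsilon> / \<epsilon>\<^sup>2" using \<epsilon> by (intro divide_left_mono) (auto intro!: mult_pos_pos add_nonneg_pos)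
    thus ?thesis using \<epsilon> by (simp add: power2_eq_square)
  qed
  have int: "integrable (lborel \<Otimes>\<^sub>M \<nu>) (\<lambda>(x, t). ?k x t)"
  proof (rule integrableI_bounded_set[where A = "{a..b} \<times> UNIV" and B = "1 / \<epsilon>"])
    show "{a..b} \<times> UNIV \<in> sets (lborel \<Otimes>\<^sub>M \<nu>)" by measurable
    show "emeasure (lborel \<Otimes>\<^sub>M \<nu>) ({a..b} \<times> UNIV) < \<infinity>"
      using ab emeasure_space_1 by (subst emeasure_pair_measure_Times) (auto simp: ennreal_mult_less_top)
    show "(\<lambda>(x, t). ?k x t) \<in> borel_measurable (lborel \<Otimes>\<^sub>M \<nu>)" by measurable
  qed (use bound \<epsilon> in \<open>auto intro!: AE_I2 simp: indicator_def\<close>)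
  have "(\<integral>x. - Im (cauchy_transform \<nu> (Complex x \<epsilon>)) * indicator {a..b} x \<partial>lborel)
      = (\<integral>x. (\<integral>t. ?k x t \<partial>\<nu>) \<partial>lborel)"
    by (simp only: neg_Im_cauchy_transform[OF \<nu> \<epsilon>] integral_mult_left_zero)
  also have "\<dots> = (\<integral>t. (\<integral>x. ?k x t \<partial>lborel) \<partial>\<nu>)"
    by (rule P.Fubini_integral[OF int, symmetric])
  also have "\<dots> = (\<integral>t. arctan ((b - t) / \<epsilon>) - arctan ((a - t) / \<epsilon>) \<partial>\<nu>)"
    by (simp only: poisson_kernel_integral[OF \<epsilon> ab])
  finally show ?thesis .
qed

text \<open>
  The value \<open>sgn 0 = 0\<close> means that an atom at an endpoint of an interval will be counted with
  half of its mass; atoms have to be excluded before interval masses can be read off.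
\<close>

lemma arctan_dilation_tendsto:
  "(\<lambda>n. arctan (c / inverse (real (Suc n)))) \<longlonglongrightarrow> pi / 2 * sgn c"
proof -
  have inf: "filterlim (\<lambda>n. real (Suc n)) at_top sequentially"
    by (rule filterlim_compose[OF filterlim_real_sequentially filterlim_Suc])
  have eq: "c / inverse (real (Suc n)) = c * real (Suc n)" for n
    by (simp only: divide_inverse inverse_inverse_eq)
  consider "c > 0" | "c = 0" | "c < 0" by linarith
  thus ?thesis
  proof cases
    case 1
    have "filterlim (\<lambda>n. c * real (Suc n)) at_top sequentially"
      by (rule filterlim_tendsto_pos_mult_at_top[OF tendsto_const 1 inf])
    from filterlim_compose[OF tendsto_arctan_at_top this] show ?thesis
      unfolding eq using 1 by (simp only: sgn_pos mult_1_right)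
  next
    case 3
    have "filterlim (\<lambda>n. c * real (Suc n)) at_bot sequentially"
      by (rule filterlim_tendsto_neg_mult_at_bot[OF tendsto_const 3 inf])
    from filterlim_compose[OF tendsto_arctan_at_bot this] show ?thesis
      unfolding eq using 3 by (simp only: sgn_neg mult_minus1_right)
  qed simp
qed

context
  fixes \<nu> :: "real measure" and g :: "complex \<Rightarrow> complex"
  assumes \<nu>: "real_distribution \<nu>"
    and g_cont: "continuous_on {z. Im z \<ge> 0} g"
    and g_eq: "\<And>z. Im z > 0 \<Longrightarrow> cauchy_transform \<nu> z = g z"
begin

interpretation real_distribution \<nu> by (rule \<nu>)

lemma boundary_value_tendsto:
  "(\<lambda>n. g (Complex x (inverse (real (Suc n))))) \<longlonglongrightarrow> g (of_real x)"
proof -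
  have "(\<lambda>n. Complex x (inverse (real (Suc n)))) \<longlonglongrightarrow> Complex x 0"
    by (intro tendsto_intros LIMSEQ_inverse_real_of_nat)
  thus ?thesis using g_cont unfolding continuous_on_sequentially
    by (auto simp: o_def complex_of_real_def)
qed

lemma boundary_value_nonneg: "- Im (g (of_real x)) \<ge> 0"
proof -
  have "(\<lambda>n. - Im (g (Complex x (inverse (real (Suc n)))))) \<longlonglongrightarrow> - Im (g (of_real x))"
    by (intro tendsto_intros boundary_value_tendsto)
  moreover have "- Im (g (Complex x (inverse (real (Suc n))))) \<ge> 0" for n
    using neg_Im_cauchy_transform[OF \<nu>, of "inverse (real (Suc n))" x] g_eq[of "Complex x (inverse (real (Suc n)))"]
    by (simp del: of_nat_Suc)
  ultimately show ?thesis by (intro LIMSEQ_le_const) auto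
qed

lemma continuous_on_boundary_value: "continuous_on S (\<lambda>x. Im (g (of_real x)))"
  by (intro continuous_intros continuous_on_compose2[OF g_cont]) auto

text \<open>
  The height above the real axis tends to \<open>0\<close> on both sides of
  \<open>cauchy_transform_interval\<close>. On the left the integrand is dominated because \<open>g\<close> is bounded on
  the compact rectangle with base \<open>{a..b}\<close> and height \<open>1\<close>.
\<close>

lemma boundary_value_interval:
  assumes ab: "a \<le> b"
  shows "(\<integral>x. - Im (g (of_real x)) * indicator {a..b} x \<partial>lborel) =
      (\<integral>t. pi / 2 * sgn (b - t) - pi / 2 * sgn (a - t) \<partial>\<nu>)"
proof (rule LIMSEQ_unique)
  let ?e = "\<lambda>n. inverse (real (Suc n))"
  let ?I = "\<lambda>n. \<integral>x. - Im (g (Complex x (?e n))) * indicator {a..b} x \<partial>lborel"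
  have "continuous_on ({a..b} \<times> {0..1}) (\<lambda>(x, y). g (Complex x y))"
    unfolding case_prod_unfold
    by (intro continuous_on_compose2[OF g_cont] continuous_intros) auto
  hence "compact ((\<lambda>(x, y). g (Complex x y)) ` ({a..b} \<times> {0..1}))"
    by (intro compact_continuous_image compact_Times) auto
  from compact_imp_bounded[OF this]
  obtain B where B: "\<And>x y. x \<in> {a..b} \<Longrightarrow> y \<in> {0..1} \<Longrightarrow> cmod (g (Complex x y)) \<le> B"
    unfolding bounded_iff by fastforce
  have meas: "(\<lambda>x. - Im (g (Complex x y)) * indicator {a..b} x) \<in> borel_measurable lborel" if "y \<ge> 0" for y
  proof -
    have "continuous_on UNIV (\<lambda>x. - Im (g (Complex x y)))"
      using that by (intro continuous_intros continuous_on_compose2[OF g_cont]) auto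
    hence [measurable]: "(\<lambda>x. - Im (g (Complex x y))) \<in> borel_measurable borel"
      by (rule borel_measurable_continuous_onI)
    show ?thesis by measurable
  qed
  show "?I \<longlonglongrightarrow> (\<integral>x. - Im (g (of_real x)) * indicator {a..b} x \<partial>lborel)"
  proof (rule integral_dominated_convergence[where w = "\<lambda>x. B * indicator {a..b} x"])
    show "AE x in lborel. (\<lambda>n. - Im (g (Complex x (?e n))) * indicator {a..b} x)
        \<longlonglongrightarrow> - Im (g (of_real x)) * indicator {a..b} x"
      by (intro AE_I2 tendsto_intros boundary_value_tendsto)
    show "AE x in lborel. norm (- Im (g (Complex x (?e n))) * indicator {a..b} x) \<le> B * indicator {a..b} x" for n
    proof (rule AE_I2)
      fix x
      have "?e n \<in> {0..1}" by (simp add: inverse_le_1_iff)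
      thus "norm (- Im (g (Complex x (?e n))) * indicator {a..b} x) \<le> B * indicator {a..b} x"
        using order.trans[OF abs_Im_le_cmod B[of x "?e n"]] by (auto simp: indicator_def)
    qed
    show "(\<lambda>x. - Im (g (of_real x)) * indicator {a..b} x) \<in> borel_measurable lborel"
      using meas[of 0] by (simp add: complex_of_real_def)
    show "(\<lambda>x. - Im (g (Complex x (?e n))) * indicator {a..b} x) \<in> borel_measurable lborel" for n
      by (rule meas) simp
    show "integrable lborel (\<lambda>x. B * indicator {a..b} x)"
      by (intro integrable_mult_right integrable_real_indicator) (use ab in auto)
  qed
  have "?I n = (\<integral>t. arctan ((b - t) / ?e n) - arctan ((a - t) / ?e n) \<partial>\<nu>)" for n
  proof -
    have e: "?e n > 0" by simp
    have "cauchy_transform \<nu> (Complex x (?e n)) = g (Complex x (?e n))" for x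
      using g_eq e by (simp del: of_nat_Suc)
    with cauchy_transform_interval[OF \<nu> e ab] show ?thesis by (simp only:)
  qed
  hence "?I = (\<lambda>n. \<integral>t. arctan ((b - t) / ?e n) - arctan ((a - t) / ?e n) \<partial>\<nu>)" by blast
  moreover have "(\<lambda>n. \<integral>t. arctan ((b - t) / ?e n) - arctan ((a - t) / ?e n) \<partial>\<nu>)
      \<longlonglongrightarrow> (\<integral>t. pi / 2 * sgn (b - t) - pi / 2 * sgn (a - t) \<partial>\<nu>)"
  proof (rule integral_dominated_convergence[where w = "\<lambda>_. pi"])
    show "AE t in \<nu>. (\<lambda>n. arctan ((b - t) / ?e n) - arctan ((a - t) / ?e n))
        \<longlonglongrightarrow> pi / 2 * sgn (b - t) - pi / 2 * sgn (a - t)"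
      by (intro AE_I2 tendsto_diff arctan_dilation_tendsto)
    show "AE t in \<nu>. norm (arctan ((b - t) / ?e n) - arctan ((a - t) / ?e n)) \<le> pi" for n
    proof (rule AE_I2)
      fix t
      show "norm (arctan ((b - t) / ?e n) - arctan ((a - t) / ?e n)) \<le> pi"
        using arctan_bounded[of "(b - t) / ?e n"] arctan_bounded[of "(a - t) / ?e n"]
        by (simp only: real_norm_def abs_le_iff) linarith
    qed
  qed auto
  ultimately show "?I \<longlonglongrightarrow> (\<integral>t. pi / 2 * sgn (b - t) - pi / 2 * sgn (a - t) \<partial>\<nu>)" by (simp only:)
qed

abbreviation boundary_mass :: "real \<Rightarrow> real \<Rightarrow> real" where
  "boundary_mass a b \<equiv> \<integral>x. - Im (g (of_real x)) * indicator {a..b} x \<partial>lborel"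

lemma integrable_half_jump: "integrable \<nu> (\<lambda>t. pi / 2 * sgn (b - t) - pi / 2 * sgn (a - t))"
  by (rule integrable_const_bound[where B = pi]) (auto intro!: AE_I2 simp: sgn_if)

lemma measure_open_interval_le:
  assumes "a \<le> b"
  shows "pi * measure \<nu> {a<..<b} \<le> boundary_mass a b"
proof -
  have "pi * measure \<nu> {a<..<b} = (\<integral>t. pi * indicator {a<..<b} t \<partial>\<nu>)" by simp
  also have "\<dots> \<le> (\<integral>t. pi / 2 * sgn (b - t) - pi / 2 * sgn (a - t) \<partial>\<nu>)"
    using assms
    by (intro integral_mono integrable_half_jump integrable_mult_right integrable_real_indicator)
       (auto simp: sgn_if indicator_def emeasure_eq_measure)
  finally show ?thesis using boundary_value_interval[OF assms] by simp
qed

lemma measure_closed_interval_ge: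
  assumes "a \<le> b"
  shows "boundary_mass a b \<le> pi * measure \<nu> {a..b}"
proof -
  have "(\<integral>t. pi / 2 * sgn (b - t) - pi / 2 * sgn (a - t) \<partial>\<nu>) \<le> (\<integral>t. pi * indicator {a..b} t \<partial>\<nu>)"
    using assms
    by (intro integral_mono integrable_half_jump integrable_mult_right integrable_real_indicator)
       (auto simp: sgn_if indicator_def emeasure_eq_measure)
  also have "\<dots> = pi * measure \<nu> {a..b}" by simp
  finally show ?thesis using boundary_value_interval[OF assms] by simp
qed

lemma integrable_boundary_value: "integrable lborel (\<lambda>x. - Im (g (of_real x)) * indicator {a..b} x)"
  using borel_integrable_compact[of "{a..b}" "\<lambda>x. - Im (g (of_real x))"] continuous_on_boundary_value
  by (simp add: indicator_def if_distrib mult_ac continuous_on_minus cong: if_cong)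

text \<open>
  A point lies in arbitrarily short open intervals, and those have mass at most a constant
  times their length since the boundary values are locally bounded.
\<close>

lemma measure_point_eq_0: "measure \<nu> {x} = 0"
proof -
  have "compact ((\<lambda>y. Im (g (of_real y))) ` {x - 1..x + 1})"
    by (intro compact_continuous_image continuous_on_boundary_value) auto
  from compact_imp_bounded[OF this]
  obtain B where "\<forall>v \<in> (\<lambda>y. Im (g (of_real y))) ` {x - 1..x + 1}. norm v \<le> B"
    unfolding bounded_iff by blast
  hence B: "\<bar>Im (g (of_real y))\<bar> \<le> B" if "y \<in> {x - 1..x + 1}" for y
    using that by auto
  have "pi * measure \<nu> {x} \<le> B * (2 * inverse (real (Suc n)))" for n
  proof -
    let ?d = "inverse (real (Suc n))"
    have d: "0 < ?d" "?d \<le> 1" by (auto simp: inverse_le_1_iff)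
    have "measure \<nu> {x} \<le> measure \<nu> {x - ?d<..<x + ?d}"
      using d by (intro finite_measure_mono) auto
    hence "pi * measure \<nu> {x} \<le> pi * measure \<nu> {x - ?d<..<x + ?d}" by simp
    also have "\<dots> \<le> boundary_mass (x - ?d) (x + ?d)"
      using d by (intro measure_open_interval_le) linarith
    also have "\<dots> \<le> (\<integral>y. B * indicator {x - ?d..x + ?d} y \<partial>lborel)"
    proof (intro integral_mono integrable_boundary_value)
      fix y
      show "- Im (g (of_real y)) * indicator {x - ?d..x + ?d} y \<le> B * indicator {x - ?d..x + ?d} y"
        using B[of y] d by (auto simp: indicator_def)
    qed simp
    also have "\<dots> = B * (2 * ?d)" using d by simp
    finally show ?thesis .
  qed
  moreover have "(\<lambda>n. B * (2 * inverse (real (Suc n)))) \<longlonglongrightarrow> B * (2 * 0)"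
    by (intro tendsto_intros LIMSEQ_inverse_real_of_nat)
  ultimately have "pi * measure \<nu> {x} \<le> B * (2 * 0)" by (intro LIMSEQ_le_const) auto
  hence "measure \<nu> {x} \<le> 0" using pi_gt_zero by (simp add: mult_le_0_iff not_le)
  thus ?thesis using measure_nonneg[of \<nu> "{x}"] by linarith
qed

lemma measure_open_interval:
  assumes "a \<le> b"
  shows "pi * measure \<nu> {a<..<b} = boundary_mass a b"
proof (rule antisym)
  \<comment> \<open>The endpoints carry no mass, so the two one-sided estimates meet.\<close>
  have "measure \<nu> {a..b} \<le> measure \<nu> ({a<..<b} \<union> {a} \<union> {b})" by (intro finite_measure_mono) auto
  also have "\<dots> \<le> measure \<nu> ({a<..<b} \<union> {a}) + measure \<nu> {b}"
    by (intro measure_Un_le) auto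
  also have "\<dots> \<le> measure \<nu> {a<..<b} + measure \<nu> {a} + measure \<nu> {b}"
    by (intro add_right_mono measure_Un_le) auto
  finally have "pi * measure \<nu> {a..b} \<le> pi * measure \<nu> {a<..<b}" by (simp add: measure_point_eq_0)
  thus "boundary_mass a b \<le> pi * measure \<nu> {a<..<b}"
    by (rule order.trans[OF measure_closed_interval_ge[OF assms]])
qed (rule measure_open_interval_le[OF assms])

text \<open>
  Stieltjes inversion for a Cauchy transform with a continuous extension to the closed upper
  half-plane: both measures give the same mass to open intervals, which generate the Borel sets.
\<close>

lemma stieltjes_inversion:
  "\<nu> = density lborel (\<lambda>x. ennreal (- Im (g (of_real x)) / pi))" (is "_ = ?M")
proof (rule measure_eqI_generator_eq)
  let ?E = "range (\<lambda>(a, b). box a b :: real set)"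
  show "Int_stable ?E" by (auto simp: Int_stable_def box_Int_box)
  show "?E \<subseteq> Pow UNIV" "sets \<nu> = sigma_sets UNIV ?E" "sets ?M = sigma_sets UNIV ?E"
    by (simp_all add: borel_eq_box)
  let ?A = "\<lambda>n::nat. box (- (real n *\<^sub>R One)) (real n *\<^sub>R One) :: real set"
  show "range ?A \<subseteq> ?E" "(\<Union>i. ?A i) = UNIV" unfolding UN_box_eq_UNIV by auto
  show "emeasure \<nu> (?A i) \<noteq> \<infinity>" for i by simp
  show "emeasure \<nu> X = emeasure ?M X" if "X \<in> ?E" for X
  proof -
    from that obtain p where "X = (\<lambda>(a, b). box a b) p" by (rule rangeE)
    then obtain a b where X: "X = {a<..<b}" by (cases p) (simp add: box_real)
    show ?thesis
    proof (cases "a \<le> b")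
      case True
      have meas: "(\<lambda>x. ennreal (- Im (g (of_real x)) / pi)) \<in> borel_measurable lborel"
        using continuous_on_boundary_value[of UNIV]
        by (intro measurable_compose[OF _ measurable_ennreal] borel_measurable_divide borel_measurable_uminus)
           (auto intro: borel_measurable_continuous_onI)
      have "emeasure ?M X = (\<integral>\<^sup>+x. ennreal (- Im (g (of_real x)) / pi) * indicator {a<..<b} x \<partial>lborel)"
        unfolding X by (rule emeasure_density[OF meas]) simp
      also have "\<dots> = (\<integral>\<^sup>+x. ennreal (- Im (g (of_real x)) * indicator {a..b} x / pi) \<partial>lborel)"
      proof (rule nn_integral_cong_AE)
        have "AE x in lborel. x \<noteq> a" "AE x in lborel. x \<noteq> b" by (rule AE_lborel_singleton)+
        thus "AE x in lborel. ennreal (- Im (g (of_real x)) / pi) * indicator {a<..<b} x =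
            ennreal (- Im (g (of_real x)) * indicator {a..b} x / pi)"
          by eventually_elim (auto simp: indicator_def)
      qed
      also have "\<dots> = ennreal (\<integral>x. - Im (g (of_real x)) * indicator {a..b} x / pi \<partial>lborel)"
        using boundary_value_nonneg
        by (intro nn_integral_eq_integral integrable_divide integrable_boundary_value AE_I2 divide_nonneg_pos mult_nonneg_nonneg) auto
      also have "\<dots> = ennreal (boundary_mass a b / pi)" by simp
      also have "\<dots> = emeasure \<nu> X"
        unfolding X measure_open_interval[OF True, symmetric] by (simp add: emeasure_eq_measure)
      finally show ?thesis by simp
    qed (simp add: X)
  qed
qed

end

section \<open>Integral representation of the auxiliary functions\<close>

text \<open>
  The Gamma law with parameter \<open>2\<close>, taken on the space \<open>{0..}\<close> instead of the whole line. Then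
  every point of the space keeps a positive distance from points of the slit plane, and bounds on
  resolvents hold everywhere rather than almost everywhere.
\<close>

definition gamma2 :: "real measure" where
  "gamma2 = density (restrict_space lborel {0..}) (\<lambda>t. ennreal (t * exp (- t)))"

definition slit_plane :: "complex set" where
  "slit_plane = {z. Im z \<noteq> 0 \<or> Re z < 0}"

lemma space_gamma2: "space gamma2 = {0..}"
  by (simp add: gamma2_def space_restrict_space)

lemma measurable_gamma2 [measurable_dest]:
  "f \<in> borel_measurable borel \<Longrightarrow> f \<in> borel_measurable gamma2"
  by (simp add: gamma2_def measurable_restrict_space1)

lemma nn_integral_gamma2:
  assumes [measurable]: "f \<in> borel_measurable borel"
  shows "(\<integral>\<^sup>+t. f t \<partial>gamma2) = (\<integral>\<^sup>+t. indicator {0..} t * ennreal (t * exp (- t)) * f t \<partial>lborel)"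
proof -
  have "(\<integral>\<^sup>+t. f t \<partial>gamma2) =
      (\<integral>\<^sup>+t. ennreal (t * exp (- t)) * f t \<partial>restrict_space lborel {0..})"
    unfolding gamma2_def by (intro nn_integral_density) (auto simp: measurable_restrict_space1)
  also have "\<dots> = (\<integral>\<^sup>+t. ennreal (t * exp (- t)) * f t * indicator {0..} t \<partial>lborel)"
    by (intro nn_integral_restrict_space) auto
  finally show ?thesis by (simp add: mult_ac)
qed

lemma integral_gamma2:
  fixes f :: "real \<Rightarrow> 'a::{banach,second_countable_topology}"
  assumes [measurable]: "f \<in> borel_measurable borel"
  shows "(\<integral>t. f t \<partial>gamma2) = (LINT t:{0..}|lborel. (t * exp (- t)) *\<^sub>R f t)"
proof -
  have "(\<integral>t. f t \<partial>gamma2) = (\<integral>t. (t * exp (- t)) *\<^sub>R f t \<partial>restrict_space lborel {0..})"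
    unfolding gamma2_def
    by (intro integral_density) (auto simp: measurable_restrict_space1 AE_restrict_space_iff)
  also have "\<dots> = (LINT t:{0..}|lborel. (t * exp (- t)) *\<^sub>R f t)"
    unfolding set_lebesgue_integral_def by (intro integral_restrict_space) auto
  finally show ?thesis .
qed

interpretation gamma2: prob_space gamma2
proof
  have "emeasure gamma2 (space gamma2) = (\<integral>\<^sup>+t. 1 \<partial>gamma2)" by simp
  also have "\<dots> = (\<integral>\<^sup>+t. ennreal (indicator {0..} t * t powr (2 - 1) / exp t) \<partial>lborel)"
    by (subst nn_integral_gamma2)
       (auto intro!: nn_integral_cong simp: indicator_def exp_minus field_simps)
  also have "\<dots> = 1"
    using Gamma_conv_nn_integral_real[of 2] Gamma_fact[of 1, where 'a = real] by simp
  finally show "emeasure gamma2 (space gamma2) = 1" .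
qed

lemma F_fun_gamma2: "F_fun z = (\<integral>t. 1 / (cmod (z - of_real t))\<^sup>2 \<partial>gamma2)"
  by (simp add: F_fun_def integral_gamma2)

lemma H_fun_gamma2: "H_fun \<alpha> z = z + of_real \<alpha> + of_real \<alpha> * (\<integral>t. 1 / (z - of_real t) \<partial>gamma2)"
  by (simp add: H_fun_def integral_gamma2 scaleR_conv_of_real)

lemma open_slit_plane: "open slit_plane"
  unfolding slit_plane_def by (intro open_Collect_disj open_Collect_neq open_Collect_less continuous_intros)

lemma slit_plane_locally_away:
  assumes "z \<in> slit_plane"
  obtains r where "r > 0" "ball z r \<subseteq> slit_plane"
    "\<And>w t. w \<in> ball z r \<Longrightarrow> t \<ge> 0 \<Longrightarrow> r \<le> cmod (w - of_real t)"
proof -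
  obtain e where e: "e > 0" "ball z e \<subseteq> slit_plane"
    using assms open_slit_plane open_contains_ball by blast
  have far: "e \<le> cmod (z - of_real t)" if "t \<ge> 0" for t
  proof (rule ccontr)
    assume "\<not> ?thesis"
    hence "of_real t \<in> ball z e" by (simp add: dist_norm)
    with e that show False by (auto simp: slit_plane_def)
  qed
  show ?thesis
  proof (rule that[of "e / 2"])
    fix w t assume "w \<in> ball z (e / 2)" "(t::real) \<ge> 0"
    thus "e / 2 \<le> cmod (w - of_real t)"
      using far[of t] norm_triangle_ineq[of "z - w" "w - of_real t"] by (simp add: dist_norm)
  qed (use e in auto)
qed

lemma slit_plane_away:
  assumes "z \<in> slit_plane"
  obtains r where "r > 0" "\<And>t. t \<ge> 0 \<Longrightarrow> r \<le> cmod (z - of_real t)"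
  using slit_plane_locally_away[OF assms] by (metis centre_in_ball)

lemma slit_plane_ne: "z \<in> slit_plane \<Longrightarrow> t \<ge> 0 \<Longrightarrow> z \<noteq> of_real t"
  by (auto simp: slit_plane_def)

lemma inverse_le: "0 < r \<Longrightarrow> r \<le> x \<Longrightarrow> 1 / x \<le> 1 / (r::real)"
  by (simp add: frac_le)

lemma integrable_resolvent:
  assumes "z \<in> slit_plane"
  shows "integrable gamma2 (\<lambda>t. 1 / (z - of_real t))"
proof -
  obtain r where r: "r > 0" "\<And>t. t \<ge> 0 \<Longrightarrow> r \<le> cmod (z - of_real t)"
    using slit_plane_away[OF assms] by blast
  show ?thesis
    by (rule gamma2.integrable_const_bound[where B = "1 / r"])
       (auto simp: space_gamma2 norm_divide r intro!: AE_I2 inverse_le)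
qed

lemma integrable_resolvent2:
  assumes "w \<in> slit_plane" "z \<in> slit_plane"
  shows "integrable gamma2 (\<lambda>t. 1 / ((w - of_real t) * (z - of_real t)))"
proof -
  obtain r where r: "r > 0" "\<And>t. t \<ge> 0 \<Longrightarrow> r \<le> cmod (z - of_real t)"
    using slit_plane_away[OF assms(2)] by blast
  obtain q where q: "q > 0" "\<And>t. t \<ge> 0 \<Longrightarrow> q \<le> cmod (w - of_real t)"
    using slit_plane_away[OF assms(1)] by blast
  show ?thesis
    by (rule gamma2.integrable_const_bound[where B = "1 / (q * r)"])
       (use q r in \<open>auto simp: space_gamma2 norm_divide norm_mult intro!: AE_I2 inverse_le mult_mono\<close>)
qed

lemma integrable_F:
  assumes "z \<in> slit_plane"
  shows "integrable gamma2 (\<lambda>t. 1 / (cmod (z - of_real t))\<^sup>2)"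
proof -
  have "integrable gamma2 (\<lambda>t. norm (1 / ((z - of_real t) * (z - of_real t))))"
    using integrable_resolvent2[OF assms assms] by (rule integrable_norm)
  thus ?thesis by (simp add: norm_divide norm_mult power2_eq_square)
qed

lemma continuous_on_F_fun: "continuous_on slit_plane F_fun"
  unfolding F_fun_gamma2[abs_def]
proof (rule continuous_on_integral_dominated)
  fix z assume "z \<in> slit_plane"
  then obtain r where r: "r > 0" "\<And>w t. w \<in> ball z r \<Longrightarrow> t \<ge> 0 \<Longrightarrow> r \<le> cmod (w - of_real t)"
    using slit_plane_locally_away by metis
  show "\<exists>r>0. \<exists>g. integrable gamma2 g \<and> (\<forall>w\<in>ball z r \<inter> slit_plane. \<forall>t\<in>space gamma2.
          norm (1 / (cmod (w - of_real t))\<^sup>2) \<le> g t)"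
    by (rule exI[of _ r], intro conjI r(1) exI[of _ "\<lambda>_. 1 / r\<^sup>2"])
       (use r in \<open>auto simp: space_gamma2 intro!: inverse_le power_mono\<close>)
next
  fix t assume "t \<in> space gamma2"
  thus "continuous_on slit_plane (\<lambda>z. 1 / (cmod (z - of_real t))\<^sup>2)"
    using slit_plane_ne by (auto simp: space_gamma2 intro!: continuous_intros)
qed auto

lemma holomorphic_on_H_fun: "H_fun \<alpha> holomorphic_on slit_plane"
proof -
  have "(\<lambda>z. \<integral>t. 1 / (z - of_real t) \<partial>gamma2) holomorphic_on slit_plane"
  proof (rule holomorphic_on_integral_dominated[OF open_slit_plane])
    fix z assume "z \<in> slit_plane"
    then obtain r where r: "r > 0" "\<And>w t. w \<in> ball z r \<Longrightarrow> t \<ge> 0 \<Longrightarrow> r \<le> cmod (w - of_real t)"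
      using slit_plane_locally_away by metis
    show "\<exists>r>0. \<exists>g. integrable gamma2 g \<and> (\<forall>w\<in>ball z r \<inter> slit_plane. \<forall>t\<in>space gamma2.
            norm (1 / (w - of_real t)) \<le> g t)"
      by (rule exI[of _ r], intro conjI r(1) exI[of _ "\<lambda>_. 1 / r"])
         (use r in \<open>auto simp: space_gamma2 norm_divide intro!: inverse_le\<close>)
  next
    fix t assume "t \<in> space gamma2"
    thus "(\<lambda>z. 1 / (z - of_real t)) holomorphic_on slit_plane"
      using slit_plane_ne by (auto simp: space_gamma2 intro!: holomorphic_intros)
  qed auto
  thus ?thesis
    unfolding H_fun_gamma2[abs_def] by (intro holomorphic_intros)
qed

text \<open>
  The identity \<open>Im (1 / (z - t)) = - Im z / |z - t|\<^sup>2\<close> is the reason why \<open>F_fun\<close> governs the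
  geometry of \<open>H_fun\<close>: the level set \<open>F_fun = 1 / \<alpha>\<close> is mapped into the real line.
\<close>

lemma Im_H_fun:
  assumes z: "z \<in> slit_plane"
  shows "Im (H_fun \<alpha> z) = Im z * (1 - \<alpha> * F_fun z)"
proof -
  have "Im (\<integral>t. 1 / (z - of_real t) \<partial>gamma2) = (\<integral>t. Im (1 / (z - of_real t)) \<partial>gamma2)"
    using integrable_resolvent[OF z] by (rule integral_Im[symmetric])
  also have "\<dots> = (\<integral>t. - Im z * (1 / (cmod (z - of_real t))\<^sup>2) \<partial>gamma2)"
    by (intro Bochner_Integration.integral_cong) (auto simp: Im_divide cmod_power2)
  also have "\<dots> = - Im z * F_fun z"
    unfolding F_fun_gamma2 by (rule integral_mult_right_zero)
  finally show ?thesis by (simp add: H_fun_gamma2 algebra_simps)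
qed

text \<open>
  Off the diagonal this is the negative of the difference quotient of \<open>\<integral>t. 1 / (z - t) \<partial>gamma2\<close>
  as a function of \<open>z\<close>.
\<close>

definition resolvent_pairing :: "complex \<Rightarrow> complex \<Rightarrow> complex" where
  "resolvent_pairing w z = (\<integral>t. 1 / ((w - of_real t) * (z - of_real t)) \<partial>gamma2)"

text \<open>
  The resolvent identity under the integral sign.
\<close>

lemma H_fun_diff:
  assumes w: "w \<in> slit_plane" and z: "z \<in> slit_plane"
  shows "H_fun \<alpha> w - H_fun \<alpha> z = (w - z) * (1 - of_real \<alpha> * resolvent_pairing w z)"
proof -
  have "(\<integral>t. 1 / (w - of_real t) \<partial>gamma2) - (\<integral>t. 1 / (z - of_real t) \<partial>gamma2)
      = (\<integral>t. 1 / (w - of_real t) - 1 / (z - of_real t) \<partial>gamma2)"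
    using integrable_resolvent w z by (intro Bochner_Integration.integral_diff[symmetric]) auto
  also have "\<dots> = (\<integral>t. - (w - z) * (1 / ((w - of_real t) * (z - of_real t))) \<partial>gamma2)"
    using slit_plane_ne[OF w] slit_plane_ne[OF z]
    by (intro Bochner_Integration.integral_cong) (auto simp: space_gamma2 field_simps)
  also have "\<dots> = - (w - z) * resolvent_pairing w z"
    unfolding resolvent_pairing_def by (rule integral_mult_right_zero)
  finally have *: "(\<integral>t. 1 / (w - of_real t) \<partial>gamma2) =
      (\<integral>t. 1 / (z - of_real t) \<partial>gamma2) - (w - z) * resolvent_pairing w z"
    by (simp add: algebra_simps)
  show ?thesis unfolding H_fun_gamma2 * by (simp add: algebra_simps)
qed

lemma gamma2_integral_pos:
  fixes f :: "real \<Rightarrow> real"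
  assumes int: "integrable gamma2 f" and pos: "\<And>t. t \<ge> 0 \<Longrightarrow> f t > 0"
  shows "(\<integral>t. f t \<partial>gamma2) > 0"
proof -
  have ne: "AE t in gamma2. f t \<noteq> 0"
    using pos by (intro AE_I2) (auto simp: space_gamma2 order_less_imp_not_eq2)
  have "\<not> (AE t in gamma2. f t = 0)"
  proof
    assume "AE t in gamma2. f t = 0"
    with ne have "AE t in gamma2. False" by eventually_elim simp
    thus False using gamma2.emeasure_space_1 by simp
  qed
  moreover have nonneg: "AE t in gamma2. 0 \<le> f t"
    by (rule AE_I2) (simp add: space_gamma2 pos less_imp_le)
  ultimately have "(\<integral>t. f t \<partial>gamma2) \<noteq> 0"
    using integral_nonneg_eq_0_iff_AE[OF int nonneg] by simp
  moreover have "(\<integral>t. f t \<partial>gamma2) \<ge> 0"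
    using nonneg by (rule integral_nonneg_AE)
  ultimately show ?thesis by simp
qed

text \<open>
  With \<open>a = 1 / (w - t)\<close> and \<open>b = 1 / (z - t)\<close> one has
  \<open>|a|\<^sup>2 + |b|\<^sup>2 - 2 Re (a b) = |a - cnj b|\<^sup>2\<close>, which is positive for every \<open>t\<close> unless \<open>w\<close>
  and \<open>z\<close> are conjugate. This one inequality yields injectivity of \<open>H_fun\<close>, monotonicity of
  \<open>P_fun\<close>, and the non-vanishing of the derivative of \<open>H_fun\<close>.
\<close>

lemma Re_resolvent_pairing_less:
  assumes w: "w \<in> slit_plane" and z: "z \<in> slit_plane" and ne: "w \<noteq> cnj z"
  shows "Re (resolvent_pairing w z) < (F_fun w + F_fun z) / 2"
proof -
  let ?a = "\<lambda>t. 1 / (w - of_real t)" and ?b = "\<lambda>t. 1 / (z - of_real t)"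
  let ?d = "\<lambda>t::real. (cmod (?a t - cnj (?b t)))\<^sup>2"
  have d: "?d t = 1 / (cmod (w - of_real t))\<^sup>2 + 1 / (cmod (z - of_real t))\<^sup>2
      - 2 * Re (1 / ((w - of_real t) * (z - of_real t)))" for t
  proof -
    have *: "(cmod (a - cnj b))\<^sup>2 = (cmod a)\<^sup>2 + (cmod b)\<^sup>2 - 2 * Re (a * b)" for a b
      unfolding cmod_power2 by (simp add: power2_eq_square algebra_simps)
    show ?thesis unfolding * by (simp add: norm_divide power_divide)
  qed
  have int: "integrable gamma2 ?d"
    unfolding d using integrable_F w z integrable_resolvent2[OF w z] by auto
  have "(\<integral>t. ?d t \<partial>gamma2) = F_fun w + F_fun z - 2 * Re (resolvent_pairing w z)"
    unfolding d F_fun_gamma2 resolvent_pairing_def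
    using integrable_F[OF w] integrable_F[OF z] integrable_resolvent2[OF w z] by (simp flip: integral_Re)
  moreover have "(\<integral>t. ?d t \<partial>gamma2) > 0"
  proof -
    have "?d t > 0" if "t \<ge> 0" for t
    proof -
      have "?a t \<noteq> cnj (?b t)"
      proof
        assume "?a t = cnj (?b t)"
        hence "w - of_real t = cnj z - of_real t"
          using slit_plane_ne[OF w that] slit_plane_ne[OF z that] by simp
        thus False using ne by simp
      qed
      thus ?thesis by simp
    qed
    thus ?thesis by (intro gamma2_integral_pos int)
  qed
  ultimately show ?thesis by simp
qed

text \<open>
  Just to the right of \<open>x\<close> the integrand times the density is at least a constant
  times \<open>1 / (t - x)\<close>, also for \<open>x = 0\<close>, where
  the density \<open>t exp (- t)\<close> cancels only one of the two powers. Cutting off at distance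
  \<open>exp (- n)\<close> makes the logarithm equal to \<open>n\<close>.
\<close>

lemma nn_integral_resolvent_diverges:
  assumes x: "x \<ge> 0"
  shows "(\<integral>\<^sup>+t. ennreal (1 / (cmod (of_real x - of_real t))\<^sup>2) \<partial>gamma2) = \<infinity>"
proof -
  let ?I = "\<integral>\<^sup>+t. ennreal (1 / (cmod (of_real x - of_real t))\<^sup>2) \<partial>gamma2"
  define k where "k = exp (- (x + 1))"
  have bound: "ennreal (k * real n) \<le> ?I" for n
  proof -
    define e where "e = exp (- real n)"
    have e: "0 < e" "e \<le> 1" by (auto simp: e_def)
    have "(\<integral>\<^sup>+t. ennreal (k * (1 / (t - x))) * indicator {x + e..x + 1} t \<partial>lborel)
        = ennreal (k * ln (x + 1 - x) - k * ln (x + e - x))"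
    proof (rule nn_integral_FTC_Icc)
      fix t assume "t \<in> {x + e..x + 1}"
      hence t: "t - x > 0" using e by simp
      show "((\<lambda>t. k * ln (t - x)) has_real_derivative k * (1 / (t - x))) (at t)"
        using t by (auto intro!: derivative_eq_intros)
      show "0 \<le> k * (1 / (t - x))" using t by (simp add: k_def)
    qed (use e in simp_all)
    also have "k * ln (x + 1 - x) - k * ln (x + e - x) = k * real n" by (simp add: e_def)
    finally have "ennreal (k * real n) =
        (\<integral>\<^sup>+t. ennreal (k * (1 / (t - x))) * indicator {x + e..x + 1} t \<partial>lborel)" by simp
    also have "\<dots> \<le> (\<integral>\<^sup>+t. indicator {0..} t * ennreal (t * exp (- t)) *
        ennreal (1 / (cmod (of_real x - of_real t))\<^sup>2) \<partial>lborel)"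
    proof (rule nn_integral_mono)
      fix t
      show "ennreal (k * (1 / (t - x))) * indicator {x + e..x + 1} t \<le>
          indicator {0..} t * ennreal (t * exp (- t)) * ennreal (1 / (cmod (of_real x - of_real t))\<^sup>2)"
      proof (cases "t \<in> {x + e..x + 1}")
        case True
        hence t: "x < t" "t \<le> x + 1" using e by auto
        have n: "cmod (of_real x - of_real t) = t - x"
          using t norm_of_real[of "x - t", where 'a = complex] by simp
        have "k * (1 / (t - x)) = (t - x) * k / (t - x)\<^sup>2" using t by (simp add: power2_eq_square)
        also have "\<dots> \<le> t * exp (- t) / (t - x)\<^sup>2"
          using t x by (intro divide_right_mono mult_mono) (auto simp: k_def)
        finally have "ennreal (k * (1 / (t - x))) \<le> ennreal (t * exp (- t) * (1 / (t - x)\<^sup>2))"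
          by (simp add: ennreal_leI)
        also have "\<dots> = ennreal (t * exp (- t)) * ennreal (1 / (t - x)\<^sup>2)"
          using t x by (intro ennreal_mult) auto
        finally show ?thesis using True t x n by simp
      qed simp
    qed
    also have "\<dots> = ?I" by (rule nn_integral_gamma2[symmetric]) simp
    finally show ?thesis .
  qed
  have "k > 0" by (simp add: k_def)
  show ?thesis
  proof (cases ?I rule: ennreal_cases)
    case (real r)
    obtain n :: nat where "r / k < real n" using reals_Archimedean2 by blast
    hence "r < k * real n" using \<open>k > 0\<close> by (simp add: field_simps)
    moreover have "k * real n \<le> r" using bound[of n] real by (simp add: ennreal_le_iff)
    ultimately show ?thesis by simp
  qed simp
qed

section \<open>The map \<open>H_fun\<close> and its inverse\<close>

text \<open>
  Points of \<open>[0, \<infinity>)\<close> have to be excluded explicitly: the integral defining \<open>F_fun\<close> diverges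
  there, and \<open>F_fun\<close> takes the default value \<open>0\<close>.
\<close>

definition upper_closure :: "real \<Rightarrow> complex set" where
  "upper_closure \<alpha> = {w. Im w \<ge> 0 \<and> w \<in> slit_plane \<and> F_fun w \<le> 1 / \<alpha>}"

definition upper_region :: "real \<Rightarrow> complex set" where
  "upper_region \<alpha> = {w. Im w > 0 \<and> F_fun w < 1 / \<alpha>}"

lemma upper_half_slit_plane: "Im w > 0 \<Longrightarrow> w \<in> slit_plane"
  by (simp add: slit_plane_def)

lemma upper_region_subset: "upper_region \<alpha> \<subseteq> upper_closure \<alpha>"
  by (auto simp: upper_region_def upper_closure_def upper_half_slit_plane)

lemma upper_closure_subset: "upper_closure \<alpha> \<subseteq> slit_plane"
  by (auto simp: upper_closure_def)

lemma nn_integral_F: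
  assumes "z \<in> slit_plane"
  shows "(\<integral>\<^sup>+t. ennreal (1 / (cmod (z - of_real t))\<^sup>2) \<partial>gamma2) = ennreal (F_fun z)"
  unfolding F_fun_gamma2 by (intro nn_integral_eq_integral integrable_F assms) auto

text \<open>
  The only danger is a limit on the cut \<open>[0, \<infinity>)\<close>, and there the integral defining
  \<open>F_fun\<close> diverges.
\<close>

lemma closed_upper_closure: "closed (upper_closure \<alpha>)"
  unfolding closed_sequential_limits
proof safe
  fix w l assume w: "\<forall>n. w n \<in> upper_closure \<alpha>" and lim: "w \<longlonglongrightarrow> l"
  have ws: "w n \<in> slit_plane" "Im (w n) \<ge> 0" "F_fun (w n) \<le> 1 / \<alpha>" for n
    using w by (auto simp: upper_closure_def)
  have "Im l \<ge> 0"
    using tendsto_Im[OF lim] ws by (intro LIMSEQ_le_const) auto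
  moreover have l: "l \<in> slit_plane"
  proof (rule ccontr)
    assume "l \<notin> slit_plane"
    hence "l = of_real (Re l)" "Re l \<ge> 0" by (auto simp: slit_plane_def complex_eq_iff)
    then obtain x where x: "l = of_real x" "x \<ge> 0" by blast
    \<comment> \<open>By Fatou's lemma the divergent integral at \<open>l\<close> would be at most \<open>1 / \<alpha>\<close>.\<close>
    have "\<infinity> = (\<integral>\<^sup>+t. ennreal (1 / (cmod (l - of_real t))\<^sup>2) \<partial>gamma2)"
      using nn_integral_resolvent_diverges x by simp
    also have "\<dots> \<le> (\<integral>\<^sup>+t. liminf (\<lambda>n. ennreal (1 / (cmod (w n - of_real t))\<^sup>2)) \<partial>gamma2)"
    proof (rule nn_integral_mono)
      fix t
      show "ennreal (1 / (cmod (l - of_real t))\<^sup>2) \<le> liminf (\<lambda>n. ennreal (1 / (cmod (w n - of_real t))\<^sup>2))"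
      proof (cases "l = of_real t")
        case False
        hence "(\<lambda>n. ennreal (1 / (cmod (w n - of_real t))\<^sup>2)) \<longlonglongrightarrow> ennreal (1 / (cmod (l - of_real t))\<^sup>2)"
          by (intro tendsto_ennrealI tendsto_intros lim) auto
        from lim_imp_Liminf[OF _ this] show ?thesis by simp
      qed simp
    qed
    also have "\<dots> \<le> liminf (\<lambda>n. (\<integral>\<^sup>+t. ennreal (1 / (cmod (w n - of_real t))\<^sup>2) \<partial>gamma2))"
      by (intro nn_integral_liminf measurable_gamma2) measurable
    also have "\<dots> \<le> liminf (\<lambda>n. ennreal (1 / \<alpha>))"
      using ws by (intro Liminf_mono always_eventually) (auto simp: nn_integral_F ennreal_leI)
    also have "\<dots> = ennreal (1 / \<alpha>)" by (simp add: Liminf_const)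
    finally show False by (simp add: top_unique)
  qed
  moreover have "F_fun l \<le> 1 / \<alpha>"
  proof -
    have "(\<lambda>n. F_fun (w n)) \<longlonglongrightarrow> F_fun l"
      using continuous_on_F_fun l ws(1) lim by (auto simp: continuous_on_sequentially o_def)
    thus ?thesis using ws(3) by (intro LIMSEQ_le_const2) auto
  qed
  ultimately show "l \<in> upper_closure \<alpha>" by (simp add: upper_closure_def)
qed

lemma open_upper_region: "open (upper_region \<alpha>)"
proof -
  have "open {w. Im w > 0}" by (intro open_Collect_less continuous_intros)
  moreover have "continuous_on {w. Im w > 0} F_fun"
    using continuous_on_F_fun by (rule continuous_on_subset) (auto simp: upper_half_slit_plane)
  ultimately have "open ({w. Im w > 0} \<inter> F_fun -` {..<1 / \<alpha>})"
    using continuous_open_preimage open_lessThan by blast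
  also have "{w. Im w > 0} \<inter> F_fun -` {..<1 / \<alpha>} = upper_region \<alpha>"
    by (auto simp: upper_region_def)
  finally show ?thesis .
qed

lemma F_fun_less:
  assumes w: "w \<in> slit_plane" and z: "z \<in> slit_plane"
    and less: "\<And>t. t \<ge> 0 \<Longrightarrow> cmod (w - of_real t) < cmod (z - of_real t)"
  shows "F_fun z < F_fun w"
proof -
  have "0 < (\<integral>t. 1 / (cmod (w - of_real t))\<^sup>2 - 1 / (cmod (z - of_real t))\<^sup>2 \<partial>gamma2)"
  proof (rule gamma2_integral_pos)
    fix t :: real assume t: "t \<ge> 0"
    have "0 < cmod (w - of_real t)" using slit_plane_ne[OF w t] by simp
    hence "1 / (cmod (z - of_real t))\<^sup>2 < 1 / (cmod (w - of_real t))\<^sup>2"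
      using less[OF t] by (intro divide_strict_left_mono power_strict_mono mult_pos_pos) auto
    thus "0 < 1 / (cmod (w - of_real t))\<^sup>2 - 1 / (cmod (z - of_real t))\<^sup>2" by simp
  qed (use integrable_F w z in auto)
  also have "\<dots> = F_fun w - F_fun z"
    unfolding F_fun_gamma2 using integrable_F w z by (intro Bochner_Integration.integral_diff) auto
  finally show ?thesis by simp
qed

lemma F_fun_vertical_less:
  assumes "Complex x y1 \<in> slit_plane" "0 \<le> y1" "y1 < y2"
  shows "F_fun (Complex x y2) < F_fun (Complex x y1)"
proof (rule F_fun_less)
  fix t :: real
  have "y1\<^sup>2 < y2\<^sup>2" using assms by (intro power_strict_mono) auto
  thus "cmod (Complex x y1 - of_real t) < cmod (Complex x y2 - of_real t)"
    by (simp add: cmod_def)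
qed (use assms in \<open>auto simp: slit_plane_def\<close>)

lemma F_fun_real_less:
  assumes "x < y" "y < 0"
  shows "F_fun (of_real x) < F_fun (of_real y)"
proof (rule F_fun_less)
  fix t :: real assume "t \<ge> 0"
  thus "cmod (of_real y - of_real t) < cmod (of_real x - of_real t)"
    using assms by (simp flip: of_real_diff)
qed (use assms in \<open>auto simp: slit_plane_def\<close>)

lemma F_fun_le_of_far:
  assumes "r > 0" and far: "\<And>t. t \<ge> 0 \<Longrightarrow> r \<le> cmod (z - of_real t)"
  shows "F_fun z \<le> 1 / r\<^sup>2"
proof -
  have "F_fun z \<le> (\<integral>t. 1 / r\<^sup>2 \<partial>gamma2)"
    unfolding F_fun_gamma2
  proof (rule integral_mono_AE')
    show "AE t in gamma2. 1 / (cmod (z - of_real t))\<^sup>2 \<le> 1 / r\<^sup>2"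
      using assms by (intro AE_I2 inverse_le power_mono) (auto simp: space_gamma2)
  qed auto
  thus ?thesis using gamma2.prob_space by simp
qed

context
  fixes \<alpha> :: real
  assumes \<alpha>: "\<alpha> > 0"
begin

lemma F_fun_small:
  assumes "r > 0" "\<alpha> < r\<^sup>2" and "\<And>t. t \<ge> 0 \<Longrightarrow> r \<le> cmod (z - of_real t)"
  shows "F_fun z < 1 / \<alpha>"
proof -
  have "F_fun z \<le> 1 / r\<^sup>2" using assms by (intro F_fun_le_of_far) auto
  also have "\<dots> < 1 / \<alpha>" using assms \<alpha> by (intro divide_strict_left_mono) auto
  finally show ?thesis .
qed

text \<open>
  Existence of a point where \<open>F_fun\<close> exceeds \<open>1 / \<alpha>\<close> comes from closedness of
  \<open>upper_closure\<close>: otherwise the negative half-line would lie in that set, and so would its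
  endpoint \<open>0\<close>.
\<close>

lemma ex1_c_const: "\<exists>!c. c > 0 \<and> F_fun (of_real (- c)) = 1 / \<alpha>"
proof -
  have "\<exists>c>0. F_fun (of_real (- c)) > 1 / \<alpha>"
  proof (rule ccontr)
    assume "\<not> ?thesis"
    hence "of_real (- c) \<in> upper_closure \<alpha>" if "c > 0" for c
      using that by (force simp: upper_closure_def slit_plane_def)
    hence in_K: "of_real (- inverse (real (Suc n))) \<in> upper_closure \<alpha>" for n
      by (metis inverse_positive_iff_positive of_nat_0_less_iff zero_less_Suc)
    have "(\<lambda>n. of_real (- inverse (real (Suc n))) :: complex) \<longlonglongrightarrow> of_real (- 0)"
      by (intro tendsto_intros LIMSEQ_inverse_real_of_nat)
    from closed_sequentially[OF closed_upper_closure in_K this]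
    have "complex_of_real (- 0) \<in> upper_closure \<alpha>" .
    thus False by (simp add: upper_closure_def slit_plane_def)
  qed
  then obtain a where a: "a > 0" "F_fun (of_real (- a)) > 1 / \<alpha>" by blast
  \<comment> \<open>At distance more than \<open>sqrt \<alpha>\<close> from \<open>[0, \<infinity>)\<close> the value of \<open>F_fun\<close> is less than \<open>1 / \<alpha>\<close>.\<close>
  define b where "b = max a (sqrt \<alpha> + 1)"
  have b: "b \<ge> a" "b > 0" "b > sqrt \<alpha>" using a by (auto simp: b_def)
  have "b\<^sup>2 > \<alpha>" using power_strict_mono[OF b(3), of 2] \<alpha> by simp
  have Fb: "F_fun (of_real (- b)) < 1 / \<alpha>"
  proof (rule F_fun_small)
    fix t :: real assume "t \<ge> 0"
    thus "b \<le> cmod (of_real (- b) - of_real t)" using b by (simp flip: of_real_diff of_real_minus)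
  qed fact+
  have "\<exists>c\<ge>a. c \<le> b \<and> F_fun (of_real (- c)) = 1 / \<alpha>"
  proof (rule IVT2')
    show "continuous_on {a..b} (\<lambda>c. F_fun (of_real (- c)))"
      using a by (intro continuous_on_compose2[OF continuous_on_F_fun] continuous_intros)
                 (auto simp: slit_plane_def)
  qed (use a b Fb in auto)
  then obtain c where c: "c > 0" "F_fun (of_real (- c)) = 1 / \<alpha>"
    using a(1) less_le_trans by blast
  have uniq: "d = c" if "d > 0" "F_fun (of_real (- d)) = 1 / \<alpha>" for d
    using F_fun_real_less[of "- c" "- d"] F_fun_real_less[of "- d" "- c"] that c
    by (cases c d rule: linorder_cases) auto
  show ?thesis by (rule ex1I[of _ c]) (use c uniq in blast)+
qed

lemma c_const_pos: "c_const \<alpha> > 0"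
  and F_fun_c_const: "F_fun (of_real (- c_const \<alpha>)) = 1 / \<alpha>"
  using theI'[OF ex1_c_const] unfolding c_const_def by auto

lemma real_in_upper_closure_iff:
  "of_real x \<in> upper_closure \<alpha> \<longleftrightarrow> x \<le> - c_const \<alpha>"
proof (cases "x < 0")
  case True
  hence "F_fun (of_real x) \<le> 1 / \<alpha> \<longleftrightarrow> x \<le> - c_const \<alpha>"
    using F_fun_real_less[of x "- c_const \<alpha>"] F_fun_real_less[of "- c_const \<alpha>" x]
      F_fun_c_const c_const_pos
    by (cases x "- c_const \<alpha>" rule: linorder_cases) auto
  thus ?thesis using True by (simp add: upper_closure_def slit_plane_def)
next
  case False
  thus ?thesis using c_const_pos by (simp add: upper_closure_def slit_plane_def)
qed

text \<open>
  If \<open>F_fun\<close> did not exceed \<open>1 / \<alpha>\<close> anywhere on the vertical half-line above \<open>x\<close>, then by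
  closedness \<open>x\<close> itself would belong to \<open>upper_closure\<close>, hence be at most \<open>- c_const \<alpha>\<close>.
\<close>

lemma ex1_v_fun:
  assumes x: "x > - c_const \<alpha>"
  shows "\<exists>!y. y > 0 \<and> F_fun (Complex x y) = 1 / \<alpha>"
proof -
  have "\<exists>y>0. F_fun (Complex x y) > 1 / \<alpha>"
  proof (rule ccontr)
    assume "\<not> ?thesis"
    hence "Complex x y \<in> upper_closure \<alpha>" if "y > 0" for y
      using that by (force simp: upper_closure_def slit_plane_def)
    hence in_K: "Complex x (inverse (real (Suc n))) \<in> upper_closure \<alpha>" for n by simp
    have "(\<lambda>n. Complex x (inverse (real (Suc n)))) \<longlonglongrightarrow> Complex x 0"
      by (intro tendsto_intros LIMSEQ_inverse_real_of_nat)
    from closed_sequentially[OF closed_upper_closure in_K this]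
    have "Complex x 0 \<in> upper_closure \<alpha>" .
    thus False using real_in_upper_closure_iff[of x] x by (simp add: complex_of_real_def)
  qed
  then obtain a where a: "a > 0" "F_fun (Complex x a) > 1 / \<alpha>" by blast
  define b where "b = max a (sqrt \<alpha> + 1)"
  have b: "b \<ge> a" "b > 0" "b > sqrt \<alpha>" using a by (auto simp: b_def)
  have "b\<^sup>2 > \<alpha>" using power_strict_mono[OF b(3), of 2] \<alpha> by simp
  have Fb: "F_fun (Complex x b) < 1 / \<alpha>"
  proof (rule F_fun_small)
    fix t :: real
    show "b \<le> cmod (Complex x b - of_real t)"
      using abs_Im_le_cmod[of "Complex x b - of_real t"] by simp
  qed fact+
  have "\<exists>c\<ge>a. c \<le> b \<and> F_fun (Complex x c) = 1 / \<alpha>"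
  proof (rule IVT2')
    show "continuous_on {a..b} (\<lambda>c. F_fun (Complex x c))"
      using a by (intro continuous_on_compose2[OF continuous_on_F_fun] continuous_intros)
                 (auto simp: slit_plane_def)
  qed (use a b Fb in auto)
  then obtain c where c: "c > 0" "F_fun (Complex x c) = 1 / \<alpha>"
    using a(1) less_le_trans by blast
  have uniq: "d = c" if "d > 0" "F_fun (Complex x d) = 1 / \<alpha>" for d
    using F_fun_vertical_less[of x c d] F_fun_vertical_less[of x d c] that c
    by (cases c d rule: linorder_cases) (auto simp: slit_plane_def)
  show ?thesis by (rule ex1I[of _ c]) (use c uniq in blast)+
qed

lemma v_fun_pos: "x > - c_const \<alpha> \<Longrightarrow> v_fun \<alpha> x > 0"
  and F_fun_v_fun: "x > - c_const \<alpha> \<Longrightarrow> F_fun (Complex x (v_fun \<alpha> x)) = 1 / \<alpha>"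
  using theI'[OF ex1_v_fun] unfolding v_fun_def by auto

lemma v_fun_zero: "x \<le> - c_const \<alpha> \<Longrightarrow> v_fun \<alpha> x = 0"
  by (simp add: v_fun_def)

definition boundary_point :: "real \<Rightarrow> complex" where
  "boundary_point x = Complex x (v_fun \<alpha> x)"

lemma boundary_point_in: "boundary_point x \<in> upper_closure \<alpha>"
proof (cases "x > - c_const \<alpha>")
  case True
  thus ?thesis using v_fun_pos[OF True] F_fun_v_fun[OF True]
    by (simp add: boundary_point_def upper_closure_def slit_plane_def)
next
  case False
  thus ?thesis using real_in_upper_closure_iff[of x]
    by (simp add: boundary_point_def v_fun_zero complex_of_real_def)
qed

text \<open>
  The boundary of the region is the graph of \<open>v_fun\<close>.
\<close>

lemma upper_closure_cases:
  assumes "w \<in> upper_closure \<alpha>"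
  shows "w \<in> upper_region \<alpha> \<or> w = boundary_point (Re w)"
proof (cases "w \<in> upper_region \<alpha>")
  case False
  let ?x = "Re w" and ?y = "Im w"
  consider "?y = 0" | "?y > 0" "F_fun w = 1 / \<alpha>"
    using False assms by (force simp: upper_region_def upper_closure_def)
  thus ?thesis
  proof cases
    case 1
    hence "w = of_real ?x" by (simp add: complex_eq_iff)
    hence "of_real ?x \<in> upper_closure \<alpha>" using assms by simp
    hence "?x \<le> - c_const \<alpha>" by (simp only: real_in_upper_closure_iff)
    thus ?thesis using 1 by (simp add: boundary_point_def v_fun_zero complex_eq_iff)
  next
    case 2
    \<comment> \<open>Otherwise \<open>w\<close> would lie above a real point with \<open>F_fun\<close> at most \<open>1 / \<alpha>\<close>, and \<open>F_fun\<close> decreases upwards.\<close>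
    have "?x > - c_const \<alpha>"
    proof (rule ccontr)
      assume "\<not> ?thesis"
      hence "Complex ?x 0 \<in> upper_closure \<alpha>"
        using real_in_upper_closure_iff[of ?x] by (simp add: complex_of_real_def)
      hence "F_fun (Complex ?x ?y) < 1 / \<alpha>"
        using F_fun_vertical_less[of ?x 0 ?y] 2 by (auto simp: upper_closure_def)
      thus False using 2 by simp
    qed
    note x = this
    have "?y > 0 \<and> F_fun (Complex ?x ?y) = 1 / \<alpha>" using 2 by simp
    moreover have "v_fun \<alpha> ?x > 0 \<and> F_fun (Complex ?x (v_fun \<alpha> ?x)) = 1 / \<alpha>"
      using v_fun_pos[OF x] F_fun_v_fun[OF x] by blast
    ultimately have "?y = v_fun \<alpha> ?x" using ex1_v_fun[OF x] by blast
    thus ?thesis by (simp add: boundary_point_def complex_eq_iff)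
  qed
qed simp

lemma H_fun_boundary_point: "H_fun \<alpha> (boundary_point x) = of_real (P_fun \<alpha> x)"
proof -
  have "Im (H_fun \<alpha> (boundary_point x)) = 0"
  proof (cases "x > - c_const \<alpha>")
    case True
    have "boundary_point x \<in> slit_plane" using boundary_point_in upper_closure_subset by blast
    thus ?thesis using F_fun_v_fun[OF True] \<alpha>
      by (simp add: Im_H_fun) (simp add: boundary_point_def)
  next
    case False
    have "boundary_point x \<in> slit_plane" using boundary_point_in upper_closure_subset by blast
    thus ?thesis using False by (simp add: Im_H_fun) (simp add: boundary_point_def v_fun_zero)
  qed
  thus ?thesis by (simp add: complex_eq_iff P_fun_def boundary_point_def)
qed

lemma Im_H_fun_pos_iff:
  assumes "Im w > 0"
  shows "Im (H_fun \<alpha> w) > 0 \<longleftrightarrow> w \<in> upper_region \<alpha>"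
  using assms \<alpha> by (simp add: Im_H_fun upper_half_slit_plane zero_less_mult_iff upper_region_def field_simps)

lemma H_fun_difference_quotient:
  assumes w: "w \<in> upper_closure \<alpha>" and z: "z \<in> upper_closure \<alpha>" and ne: "w \<noteq> cnj z"
  shows "Re (1 - of_real \<alpha> * resolvent_pairing w z) > 0"
proof -
  have "Re (resolvent_pairing w z) < (F_fun w + F_fun z) / 2"
    using Re_resolvent_pairing_less w z ne upper_closure_subset by blast
  also have "\<dots> \<le> 1 / \<alpha>" using w z by (simp add: upper_closure_def)
  finally show ?thesis using \<alpha> by (simp add: field_simps)
qed

lemma H_fun_secant:
  assumes "w \<in> upper_closure \<alpha>" "z \<in> upper_closure \<alpha>" "w \<noteq> z"
  obtains q where "Re q > 0" "H_fun \<alpha> w - H_fun \<alpha> z = (w - z) * q"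
proof (rule that)
  have "w \<noteq> cnj z" using assms by (auto simp: upper_closure_def complex_eq_iff)
  thus "Re (1 - of_real \<alpha> * resolvent_pairing w z) > 0"
    using H_fun_difference_quotient assms by blast
  show "H_fun \<alpha> w - H_fun \<alpha> z = (w - z) * (1 - of_real \<alpha> * resolvent_pairing w z)"
    using assms upper_closure_subset by (intro H_fun_diff) auto
qed

lemma inj_on_H_fun: "inj_on (H_fun \<alpha>) (upper_closure \<alpha>)"
proof (rule inj_onI, rule ccontr)
  fix w z assume wz: "w \<in> upper_closure \<alpha>" "z \<in> upper_closure \<alpha>" "H_fun \<alpha> w = H_fun \<alpha> z" "w \<noteq> z"
  obtain q where "Re q > 0" "H_fun \<alpha> w - H_fun \<alpha> z = (w - z) * q"
    using H_fun_secant wz by metis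
  thus False using wz by auto
qed

text \<open>
  The difference of two boundary points is the real number \<open>P y - P x\<close> divided by a \<open>q\<close> with
  positive real part, so that its real part \<open>y - x\<close> has the sign of \<open>P y - P x\<close>.
\<close>

lemma strict_mono_P_fun: "strict_mono (P_fun \<alpha>)"
proof (rule strict_monoI)
  fix x y :: real assume xy: "x < y"
  hence "boundary_point y \<noteq> boundary_point x" by (simp add: boundary_point_def)
  then obtain q where q: "Re q > 0"
    "H_fun \<alpha> (boundary_point y) - H_fun \<alpha> (boundary_point x) = (boundary_point y - boundary_point x) * q"
    using H_fun_secant boundary_point_in by metis
  hence "(boundary_point y - boundary_point x) * q = of_real (P_fun \<alpha> y - P_fun \<alpha> x)"
    by (simp add: H_fun_boundary_point)
  hence "boundary_point y - boundary_point x = of_real (P_fun \<alpha> y - P_fun \<alpha> x) / q"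
    using q(1) by (subst eq_divide_eq) auto
  hence "boundary_point y - boundary_point x = of_real (P_fun \<alpha> y - P_fun \<alpha> x) * inverse q"
    by (simp only: divide_inverse)
  hence "Re (boundary_point y - boundary_point x) = Re (of_real (P_fun \<alpha> y - P_fun \<alpha> x) * inverse q)"
    by simp
  hence "y - x = (P_fun \<alpha> y - P_fun \<alpha> x) * Re (inverse q)"
    by (simp add: boundary_point_def del: of_real_diff)
  moreover have "Re (inverse q) > 0" using q by (auto simp: Re_divide intro!: divide_pos_pos add_pos_nonneg)
  ultimately show "P_fun \<alpha> x < P_fun \<alpha> y"
    using xy by (metis diff_gt_0_iff_gt zero_less_mult_iff less_asym)
qed

text \<open>
  Where \<open>F_fun\<close> is bounded, so is the integral of \<open>1 / |w - t|\<close>, because \<open>u \<le> 1 + u\<^sup>2\<close>. Hence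
  \<open>H_fun\<close> is a bounded perturbation of the identity and in particular proper.
\<close>

lemma H_fun_near_identity:
  assumes "w \<in> upper_closure \<alpha>"
  shows "cmod (H_fun \<alpha> w - w) \<le> 2 * \<alpha> + 1"
proof -
  have w: "w \<in> slit_plane" "F_fun w \<le> 1 / \<alpha>" using assms by (auto simp: upper_closure_def)
  have "cmod (\<integral>t. 1 / (w - of_real t) \<partial>gamma2) \<le> (\<integral>t. 1 + 1 / (cmod (w - of_real t))\<^sup>2 \<partial>gamma2)"
  proof (rule order.trans[OF integral_norm_bound integral_mono])
    fix t
    have "u \<le> 1 + u\<^sup>2" for u :: real
      using sum_squares_bound[of u 1, simplified] zero_le_power2[of u] by linarith
    from this[of "1 / cmod (w - of_real t)"]
    show "cmod (1 / (w - of_real t)) \<le> 1 + 1 / (cmod (w - of_real t))\<^sup>2"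
      by (simp add: norm_divide power_divide)
  qed (use integrable_resolvent[OF w(1)] integrable_F[OF w(1)] in auto)
  also have "\<dots> = 1 + F_fun w"
    unfolding F_fun_gamma2 using integrable_F[OF w(1)] gamma2.prob_space by simp
  also have "\<dots> \<le> 1 + 1 / \<alpha>" using w by simp
  finally have "\<alpha> * cmod (\<integral>t. 1 / (w - of_real t) \<partial>gamma2) \<le> \<alpha> * (1 + 1 / \<alpha>)"
    using \<alpha> by (intro mult_left_mono) auto
  moreover have "\<alpha> * (1 + 1 / \<alpha>) = \<alpha> + 1" using \<alpha> by (simp add: field_simps)
  ultimately have "cmod (of_real \<alpha> * (\<integral>t. 1 / (w - of_real t) \<partial>gamma2)) \<le> \<alpha> + 1"
    using \<alpha> by (simp add: norm_mult)
  moreover have "cmod (of_real \<alpha>) = \<alpha>" using \<alpha> by simp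
  moreover have "H_fun \<alpha> w - w = of_real \<alpha> + of_real \<alpha> * (\<integral>t. 1 / (w - of_real t) \<partial>gamma2)"
    by (simp add: H_fun_gamma2)
  ultimately show ?thesis
    using norm_triangle_ineq[of "of_real \<alpha>" "of_real \<alpha> * (\<integral>t. 1 / (w - of_real t) \<partial>gamma2)"] by simp
qed

lemma continuous_on_H_fun: "continuous_on (upper_closure \<alpha>) (H_fun \<alpha>)"
  using holomorphic_on_H_fun upper_closure_subset
  by (meson continuous_on_subset holomorphic_on_imp_continuous_on)

text \<open>
  Properness in sequential form; closedness of the image and continuity of the inverse follow.
\<close>

lemma H_fun_limit_point:
  assumes w: "\<And>n. w n \<in> upper_closure \<alpha>" and lim: "(\<lambda>n. H_fun \<alpha> (w n)) \<longlonglongrightarrow> z"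
  obtains l r where "l \<in> upper_closure \<alpha>" "H_fun \<alpha> l = z" "strict_mono r" "(w \<circ> r) \<longlonglongrightarrow> l"
proof -
  obtain B where B: "\<And>n. cmod (H_fun \<alpha> (w n)) \<le> B"
    using convergent_imp_bounded[OF lim] by (auto simp: bounded_iff)
  have "cmod (w n) \<le> B + (2 * \<alpha> + 1)" for n
    using H_fun_near_identity[OF w[of n]] B[of n]
      norm_triangle_ineq2[of "w n" "H_fun \<alpha> (w n)"] by (simp add: norm_minus_commute)
  hence "bounded (range w)" by (auto simp: bounded_iff)
  then obtain l r where r: "strict_mono r" "(w \<circ> r) \<longlonglongrightarrow> l"
    using bounded_imp_convergent_subsequence by metis
  have l: "l \<in> upper_closure \<alpha>"
    using closed_upper_closure r(2) w closed_sequentially[of "upper_closure \<alpha>" "w \<circ> r" l] by auto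
  have "(\<lambda>n. H_fun \<alpha> ((w \<circ> r) n)) \<longlonglongrightarrow> H_fun \<alpha> l"
    using continuous_on_H_fun l r(2) w unfolding continuous_on_sequentially by (auto simp: o_def)
  moreover have "(\<lambda>n. H_fun \<alpha> ((w \<circ> r) n)) \<longlonglongrightarrow> z"
    using LIMSEQ_subseq_LIMSEQ[OF lim r(1)] by (simp add: o_def)
  ultimately have "H_fun \<alpha> l = z" by (rule LIMSEQ_unique)
  with that l r show ?thesis by blast
qed

lemma closed_H_fun_image: "closed (H_fun \<alpha> ` upper_closure \<alpha>)"
  unfolding closed_sequential_limits
proof safe
  fix z l assume z: "\<forall>n. z n \<in> H_fun \<alpha> ` upper_closure \<alpha>" "z \<longlonglongrightarrow> l"
  then obtain w where w: "\<And>n. w n \<in> upper_closure \<alpha>" "\<And>n. z n = H_fun \<alpha> (w n)"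
    unfolding image_iff by metis
  have "(\<lambda>n. H_fun \<alpha> (w n)) \<longlonglongrightarrow> l" using z(2) by (simp flip: w(2))
  from H_fun_limit_point[OF w(1) this] show "l \<in> H_fun \<alpha> ` upper_closure \<alpha>" by blast
qed

text \<open>
  The image of the region is open by the open mapping theorem and relatively closed by
  properness, hence all of the connected upper half-plane.
\<close>

lemma H_fun_image_region: "H_fun \<alpha> ` upper_region \<alpha> = {z. Im z > 0}"
proof -
  let ?U = "{z::complex. Im z > 0}" and ?V = "H_fun \<alpha> ` upper_region \<alpha>"
  have eq: "?V = ?U \<inter> H_fun \<alpha> ` upper_closure \<alpha>"
  proof safe
    fix w assume "w \<in> upper_region \<alpha>"
    thus "0 < Im (H_fun \<alpha> w)" "H_fun \<alpha> w \<in> H_fun \<alpha> ` upper_closure \<alpha>"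
      using Im_H_fun_pos_iff upper_region_subset by (auto simp: upper_region_def)
  next
    fix w assume w: "w \<in> upper_closure \<alpha>" "0 < Im (H_fun \<alpha> w)"
    have "w \<noteq> boundary_point (Re w)"
    proof
      assume "w = boundary_point (Re w)"
      hence "H_fun \<alpha> w = of_real (P_fun \<alpha> (Re w))" using H_fun_boundary_point[of "Re w"] by simp
      thus False using w(2) by simp
    qed
    thus "H_fun \<alpha> w \<in> ?V" using upper_closure_cases[OF w(1)] by blast
  qed
  have "connected ?U"
    by (intro convex_connected convex_halfspace_Im_gt)
  moreover have "openin (top_of_set ?U) ?V"
  proof -
    have "open ?V"
    proof (rule open_mapping_thm3)
      show "H_fun \<alpha> holomorphic_on upper_region \<alpha>"
        using holomorphic_on_H_fun upper_region_subset upper_closure_subset by (meson holomorphic_on_subset)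
      show "inj_on (H_fun \<alpha>) (upper_region \<alpha>)"
        using inj_on_H_fun upper_region_subset by (rule inj_on_subset)
    qed (rule open_upper_region)
    thus ?thesis using eq by (auto intro: openin_open_subtopology simp: openin_open)
  qed
  moreover have "closedin (top_of_set ?U) ?V"
    unfolding eq using closed_H_fun_image by (rule closedin_closed_Int)
  moreover have "?V \<noteq> {}"
  proof -
    have "Complex 0 (sqrt \<alpha> + 1) \<in> upper_region \<alpha>"
    proof -
      have s: "sqrt \<alpha> > 0" using \<alpha> by simp
      have "F_fun (Complex 0 (sqrt \<alpha> + 1)) < 1 / \<alpha>"
      proof (rule F_fun_small)
        have "sqrt \<alpha> ^ 2 < (sqrt \<alpha> + 1)\<^sup>2" using s by (intro power_strict_mono) auto
        thus "\<alpha> < (sqrt \<alpha> + 1)\<^sup>2" using \<alpha> by simp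
        show "sqrt \<alpha> + 1 \<le> cmod (Complex 0 (sqrt \<alpha> + 1) - of_real t)" for t
          using abs_Im_le_cmod[of "Complex 0 (sqrt \<alpha> + 1) - of_real t"] by simp
      qed (use s in linarith)
      moreover have "sqrt \<alpha> + 1 > 0" using s by linarith
      ultimately show ?thesis by (simp add: upper_region_def)
    qed
    thus ?thesis by blast
  qed
  ultimately show ?thesis unfolding connected_clopen by blast
qed

lemma H_fun_image_closure: "H_fun \<alpha> ` upper_closure \<alpha> = {z. Im z \<ge> 0}"
proof
  show "H_fun \<alpha> ` upper_closure \<alpha> \<subseteq> {z. Im z \<ge> 0}"
  proof safe
    fix w assume "w \<in> upper_closure \<alpha>"
    from upper_closure_cases[OF this] show "0 \<le> Im (H_fun \<alpha> w)"
    proof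
      assume "w \<in> upper_region \<alpha>"
      hence "H_fun \<alpha> w \<in> {z. Im z > 0}" using H_fun_image_region by blast
      thus ?thesis by simp
    next
      assume "w = boundary_point (Re w)"
      hence "H_fun \<alpha> w = of_real (P_fun \<alpha> (Re w))" using H_fun_boundary_point[of "Re w"] by simp
      thus ?thesis by simp
    qed
  qed
  show "{z. Im z \<ge> 0} \<subseteq> H_fun \<alpha> ` upper_closure \<alpha>"
  proof
    fix z :: complex assume z: "z \<in> {z. Im z \<ge> 0}"
    have "z + \<i> * of_real (inverse (real (Suc n))) \<in> H_fun \<alpha> ` upper_region \<alpha>" for n
      unfolding H_fun_image_region using z by (simp add: add_nonneg_pos)
    hence in_K: "z + \<i> * of_real (inverse (real (Suc n))) \<in> H_fun \<alpha> ` upper_closure \<alpha>" for n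
      using upper_region_subset by blast
    have "(\<lambda>n. z + \<i> * of_real (inverse (real (Suc n)))) \<longlonglongrightarrow> z + \<i> * of_real 0"
      by (intro tendsto_intros LIMSEQ_inverse_real_of_nat)
    from closed_sequentially[OF closed_H_fun_image in_K this]
    show "z \<in> H_fun \<alpha> ` upper_closure \<alpha>" by simp
  qed
qed

text \<open>
  Only the values on the closed upper half-plane, which is the image of \<open>upper_closure\<close>, are
  meaningful.
\<close>

definition H_inv :: "complex \<Rightarrow> complex" where
  "H_inv = the_inv_into (upper_closure \<alpha>) (H_fun \<alpha>)"

lemma H_inv_H_fun: "w \<in> upper_closure \<alpha> \<Longrightarrow> H_inv (H_fun \<alpha> w) = w"
  unfolding H_inv_def using inj_on_H_fun by (rule the_inv_into_f_f)

lemma H_inv_in: "Im z \<ge> 0 \<Longrightarrow> H_inv z \<in> upper_closure \<alpha>"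
  and H_fun_H_inv: "Im z \<ge> 0 \<Longrightarrow> H_fun \<alpha> (H_inv z) = z"
  using H_fun_image_closure H_inv_H_fun by (force simp: image_iff set_eq_iff)+

lemma continuous_on_H_inv: "continuous_on {z. Im z \<ge> 0} H_inv"
proof (rule continuous_on_sequentiallyI)
  fix u a assume u: "\<forall>n. u n \<in> {z::complex. Im z \<ge> 0}" "a \<in> {z. Im z \<ge> 0}" "u \<longlonglongrightarrow> a"
  show "(\<lambda>n. H_inv (u n)) \<longlonglongrightarrow> H_inv a"
  proof (rule ccontr)
    assume "\<not> ?thesis"
    then obtain e where e: "e > 0" "\<exists>\<^sub>F n in sequentially. dist (H_inv (u n)) (H_inv a) \<ge> e"
      unfolding tendsto_iff by (auto simp: not_eventually not_less)
    hence "infinite {n. dist (H_inv (u n)) (H_inv a) \<ge> e}"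
      by (simp add: frequently_sequentially infinite_nat_iff_unbounded_le)
    from infinite_enumerate[OF this]
    obtain r :: "nat \<Rightarrow> nat" where r: "strict_mono r" "\<forall>n. r n \<in> {n. dist (H_inv (u n)) (H_inv a) \<ge> e}"
      by blast
    have "(\<lambda>n. H_fun \<alpha> (H_inv (u (r n)))) \<longlonglongrightarrow> a"
      using LIMSEQ_subseq_LIMSEQ[OF u(3) r(1)] u(1) by (simp add: H_fun_H_inv o_def)
    moreover have "H_inv (u (r n)) \<in> upper_closure \<alpha>" for n using H_inv_in u(1) by auto
    ultimately obtain l q where l: "l \<in> upper_closure \<alpha>" "H_fun \<alpha> l = a"
        "((\<lambda>n. H_inv (u (r n))) \<circ> q) \<longlonglongrightarrow> l"
      using H_fun_limit_point[of "\<lambda>n. H_inv (u (r n))" a] by blast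
    have "H_inv a = l" using l H_inv_H_fun by metis
    with l(3) e(1) obtain n where "dist (((\<lambda>n. H_inv (u (r n))) \<circ> q) n) (H_inv a) < e"
      unfolding lim_sequentially by blast
    moreover have "dist (H_inv (u (r (q n)))) (H_inv a) \<ge> e" using r(2) by blast
    ultimately show False by simp
  qed
qed

lemma holomorphic_on_H_inv: "H_inv holomorphic_on {z. Im z > 0}"
proof -
  have "H_fun \<alpha> holomorphic_on upper_region \<alpha>"
    using holomorphic_on_H_fun upper_region_subset upper_closure_subset by (meson holomorphic_on_subset)
  moreover have "inj_on (H_fun \<alpha>) (upper_region \<alpha>)"
    using inj_on_H_fun upper_region_subset by (rule inj_on_subset)
  ultimately obtain g where g: "g holomorphic_on (H_fun \<alpha> ` upper_region \<alpha>)"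
    "\<And>z. z \<in> upper_region \<alpha> \<Longrightarrow> g (H_fun \<alpha> z) = z"
    using holomorphic_has_inverse[OF _ open_upper_region] by metis
  have "g z = H_inv z" if "z \<in> {z. Im z > 0}" for z
  proof -
    obtain w where w: "w \<in> upper_region \<alpha>" "z = H_fun \<alpha> w"
      using \<open>z \<in> {z. Im z > 0}\<close> unfolding H_fun_image_region[symmetric] by blast
    moreover have "w \<in> upper_closure \<alpha>" using w(1) upper_region_subset by blast
    ultimately show ?thesis using g(2) H_inv_H_fun by simp
  qed
  thus ?thesis using g(1) holomorphic_transform unfolding H_fun_image_region by blast
qed

lemma H_inv_real: "H_inv (of_real (P_fun \<alpha> x)) = boundary_point x"
  using H_inv_H_fun[OF boundary_point_in] by (simp add: H_fun_boundary_point)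

lemma surj_P_fun: "surj (P_fun \<alpha>)"
proof -
  have "\<exists>x. \<xi> = P_fun \<alpha> x" for \<xi>
  proof -
    let ?w = "H_inv (of_real \<xi>)"
    have w: "?w \<in> upper_closure \<alpha>" "H_fun \<alpha> ?w = of_real \<xi>" by (simp_all add: H_inv_in H_fun_H_inv)
    have "?w \<notin> upper_region \<alpha>"
    proof
      assume "?w \<in> upper_region \<alpha>"
      hence "H_fun \<alpha> ?w \<in> {z. Im z > 0}" using H_fun_image_region by blast
      thus False using w(2) by simp
    qed
    hence "?w = boundary_point (Re ?w)" using upper_closure_cases w(1) by blast
    hence "of_real \<xi> = complex_of_real (P_fun \<alpha> (Re ?w))" using w(2) H_fun_boundary_point by metis
    thus ?thesis by (metis of_real_eq_iff)
  qed
  thus ?thesis by (simp add: surj_def)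
qed

lemma H_inv_of_real: "H_inv (of_real \<xi>) = boundary_point (inv (P_fun \<alpha>) \<xi>)"
  using H_inv_real[of "inv (P_fun \<alpha>) \<xi>"] surj_P_fun by (simp add: surj_f_inv_f)

end

section \<open>Laplace transform of the Gamma law\<close>

lemma nn_integral_gamma_scaled:
  fixes \<alpha> s :: real
  assumes "\<alpha> > 0" "s > 0"
  shows "(\<integral>\<^sup>+t. ennreal (indicator {0..} t * t powr (\<alpha> - 1) * exp (- (s * t))) \<partial>lborel)
    = ennreal (Gamma \<alpha> * s powr (- \<alpha>))"
proof -
  have *: "indicator {0..} (0 + 1 / s * x) * (0 + 1 / s * x) powr (\<alpha> - 1) * exp (- (s * (0 + 1 / s * x)))
      = s powr (1 - \<alpha>) * (indicator {0..} x * x powr (\<alpha> - 1) / exp x)" for x :: real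
  proof (cases "x \<ge> 0")
    case True
    hence "(x / s) powr (\<alpha> - 1) = x powr (\<alpha> - 1) * s powr (1 - \<alpha>)"
      using assms powr_minus[of s "\<alpha> - 1"] by (simp add: powr_divide) (simp add: divide_inverse)
    thus ?thesis using True assms by (simp add: exp_minus; simp add: divide_inverse)
  next
    case False
    thus ?thesis using assms by (simp add: indicator_def zero_le_divide_iff)
  qed
  have scale: "(\<integral>\<^sup>+x. ennreal (c * g x) \<partial>lborel) = ennreal c * (\<integral>\<^sup>+x. ennreal (g x) \<partial>lborel)"
    if "c \<ge> 0" "g \<in> borel_measurable borel" for c and g :: "real \<Rightarrow> real"
    using that by (simp add: ennreal_mult' nn_integral_cmult)
  have "(\<integral>\<^sup>+t. ennreal (indicator {0..} t * t powr (\<alpha> - 1) * exp (- (s * t))) \<partial>lborel)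
      = ennreal \<bar>1 / s\<bar> * (\<integral>\<^sup>+x. ennreal (s powr (1 - \<alpha>) * (indicator {0..} x * x powr (\<alpha> - 1) / exp x)) \<partial>lborel)"
    using assms unfolding *[symmetric] by (intro nn_integral_real_affine) auto
  also have "\<dots> = ennreal \<bar>1 / s\<bar> * (ennreal (s powr (1 - \<alpha>)) *
      (\<integral>\<^sup>+x. ennreal (indicator {0..} x * x powr (\<alpha> - 1) / exp x) \<partial>lborel))"
    by (subst scale) auto
  also have "\<dots> = ennreal (1 / s * (s powr (1 - \<alpha>) * Gamma \<alpha>))"
    unfolding Gamma_conv_nn_integral_real[OF assms(1), symmetric]
    using assms by (simp add: ennreal_mult'[symmetric] mult.assoc)
  also have "1 / s * (s powr (1 - \<alpha>) * Gamma \<alpha>) = Gamma \<alpha> * s powr (- \<alpha>)"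
    using assms by (simp add: powr_diff powr_minus divide_inverse)
  finally show ?thesis .
qed

lemma has_bochner_integral_gamma_scaled:
  fixes \<alpha> s :: real
  assumes "\<alpha> > 0" "s > 0"
  shows "has_bochner_integral lborel (\<lambda>t. indicator {0..} t * t powr (\<alpha> - 1) * exp (- (s * t)))
    (Gamma \<alpha> * s powr (- \<alpha>))"
  using assms by (intro has_bochner_integral_nn_integral nn_integral_gamma_scaled)
    (auto simp: Gamma_real_pos less_imp_le)

lemma gamma_density_nonneg:
  "\<alpha> > 0 \<Longrightarrow> 0 \<le> indicator {0..} t * t powr (\<alpha> - 1) * exp (- t) / Gamma (\<alpha> :: real)"
  by (simp add: Gamma_real_pos less_imp_le)

lemma integral_gamma_distribution:
  fixes f :: "real \<Rightarrow> 'a::{banach,second_countable_topology}"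
  assumes "\<alpha> > 0" and [measurable]: "f \<in> borel_measurable borel"
  shows "(\<integral>t. f t \<partial>gamma_distribution \<alpha>) =
    (\<integral>t. (indicator {0..} t * t powr (\<alpha> - 1) * exp (- t) / Gamma \<alpha>) *\<^sub>R f t \<partial>lborel)"
  unfolding gamma_distribution_def using gamma_density_nonneg[OF assms(1)]
  by (intro integral_density) auto

lemma integrable_gamma_distribution:
  fixes f :: "real \<Rightarrow> 'a::{banach,second_countable_topology}"
  assumes "\<alpha> > 0" and [measurable]: "f \<in> borel_measurable borel"
  shows "integrable (gamma_distribution \<alpha>) f \<longleftrightarrow>
    integrable lborel (\<lambda>t. (indicator {0..} t * t powr (\<alpha> - 1) * exp (- t) / Gamma \<alpha>) *\<^sub>R f t)"
  unfolding gamma_distribution_def using gamma_density_nonneg[OF assms(1)]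
  by (intro integrable_density) auto

lemma prob_space_gamma_distribution:
  assumes "\<alpha> > 0"
  shows "prob_space (gamma_distribution \<alpha>)"
proof
  have "emeasure (gamma_distribution \<alpha>) (space (gamma_distribution \<alpha>)) =
      (\<integral>\<^sup>+t. ennreal (indicator {0..} t * t powr (\<alpha> - 1) * exp (- (1 * t))) / ennreal (Gamma \<alpha>) \<partial>lborel)"
    using assms by (auto simp: gamma_distribution_def emeasure_density divide_ennreal Gamma_real_pos
        intro!: nn_integral_cong)
  also have "\<dots> = ennreal (Gamma \<alpha> * 1 powr (- \<alpha>)) / ennreal (Gamma \<alpha>)"
    using nn_integral_gamma_scaled[OF assms zero_less_one]
    by (subst nn_integral_divide) auto
  also have "\<dots> = 1"
    using Gamma_real_pos[OF assms] by (simp add: divide_ennreal)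
  finally show "emeasure (gamma_distribution \<alpha>) (space (gamma_distribution \<alpha>)) = 1" .
qed

lemma sets_gamma_distribution [measurable_cong, simp]: "sets (gamma_distribution \<alpha>) = sets borel"
  by (simp add: gamma_distribution_def)

lemma islimpt_positive_reals: "(1::complex) islimpt of_real ` {0<..}"
  unfolding islimpt_approachable
proof safe
  fix e :: real assume "e > 0"
  moreover from this have "complex_of_real (1 + e / 2) \<in> of_real ` {0<..}" by (intro imageI) simp
  ultimately show "\<exists>x'\<in>complex_of_real ` {0<..}. x' \<noteq> 1 \<and> dist x' 1 < e"
    by (intro bexI[of _ "of_real (1 + e / 2)"]) (auto simp: dist_norm)
qed

text \<open>
  Both sides are holomorphic for \<open>Re s > 0\<close>, and for real \<open>s\<close> the formula is the scaled
  Gamma integral.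
\<close>

lemma laplace_gamma_kernel:
  fixes \<alpha> :: real and s :: complex
  assumes \<alpha>: "\<alpha> > 0" and s: "Re s > 0"
  shows "(\<integral>t. (indicator {0..} t * t powr (\<alpha> - 1)) *\<^sub>R exp (- (s * of_real t)) \<partial>lborel)
    = of_real (Gamma \<alpha>) * exp (- (of_real \<alpha> * Ln s))"
proof -
  let ?S = "{s. Re s > 0}"
  let ?L = "\<lambda>s. \<integral>t. (indicator {0..} t * t powr (\<alpha> - 1)) *\<^sub>R exp (- (s * complex_of_real t)) \<partial>lborel"
  let ?R = "\<lambda>s. of_real (Gamma \<alpha>) * exp (- (of_real \<alpha> * Ln s))"
  have open_S: "open ?S" by (intro open_Collect_less continuous_intros)
  have "?L holomorphic_on ?S"
  proof (rule holomorphic_on_integral_dominated[OF open_S])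
    fix z assume z: "z \<in> ?S"
    let ?g = "\<lambda>t. indicator {0..} t * t powr (\<alpha> - 1) * exp (- ((Re z / 2) * t))"
    show "\<exists>r>0. \<exists>g. integrable lborel g \<and> (\<forall>w\<in>ball z r \<inter> ?S. \<forall>t\<in>space lborel.
        norm ((indicator {0..} t * t powr (\<alpha> - 1)) *\<^sub>R exp (- (w * complex_of_real t))) \<le> g t)"
    proof (intro exI conjI ballI)
      show "Re z / 2 > 0" using z by simp
      show "integrable lborel ?g"
        using has_bochner_integral_gamma_scaled[OF \<alpha>, of "Re z / 2"] z by (auto simp: has_bochner_integral_iff)
      fix w :: complex and t :: real assume w: "w \<in> ball z (Re z / 2) \<inter> ?S"
      have "cmod (z - w) < Re z / 2" using w by (simp add: dist_norm)
      hence "Re z - Re w \<le> Re z / 2" using abs_Re_le_cmod[of "z - w"] by simp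
      hence "t \<ge> 0 \<Longrightarrow> Re z / 2 * t \<le> Re w * t" by (intro mult_right_mono) auto
      thus "norm ((indicator {0..} t * t powr (\<alpha> - 1)) *\<^sub>R exp (- (w * complex_of_real t))) \<le> ?g t"
        by (auto simp: indicator_def norm_exp_eq_Re intro!: mult_left_mono)
    qed
  qed (auto intro!: holomorphic_intros)
  moreover have "?R holomorphic_on ?S"
    by (intro holomorphic_intros) (auto simp: complex_nonpos_Reals_iff)
  ultimately have "(\<lambda>s. ?L s - ?R s) holomorphic_on ?S" by (rule holomorphic_on_diff)
  moreover have "?L s - ?R s = 0" if "s \<in> of_real ` {0<..}" for s
  proof -
    from that obtain x where x: "s = of_real x" "x > 0" by auto
    have "?L s = (\<integral>t. of_real (indicator {0..} t * t powr (\<alpha> - 1) * exp (- (x * t))) \<partial>lborel)"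
      unfolding x by (intro Bochner_Integration.integral_cong) (auto simp: scaleR_conv_of_real exp_of_real[symmetric])
    also have "\<dots> = of_real (Gamma \<alpha> * x powr (- \<alpha>))"
      using has_bochner_integral_gamma_scaled[OF \<alpha> x(2)] by (subst integral_of_real) (auto simp: has_bochner_integral_iff)
    also have "\<dots> = ?R s"
      using x by (simp add: powr_def Ln_of_real exp_of_real[symmetric])
    finally show ?thesis by simp
  qed
  moreover have "connected ?S" by (intro convex_connected convex_halfspace_Re_gt)
  ultimately have "?L s - ?R s = 0"
    using open_S islimpt_positive_reals s
    by (elim analytic_continuation[where U = "of_real ` {0<..}" and \<xi> = 1]) auto
  thus ?thesis by simp
qed

lemma laplace_gamma_distribution:
  fixes \<alpha> :: real and p :: complex
  assumes \<alpha>: "\<alpha> > 0" and p: "Re p < 1"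
  shows "(\<integral>t. exp (p * of_real t) \<partial>gamma_distribution \<alpha>) = exp (- (of_real \<alpha> * Ln (1 - p)))"
proof -
  have "(\<integral>t. exp (p * of_real t) \<partial>gamma_distribution \<alpha>) =
      (\<integral>t. ((indicator {0..} t * t powr (\<alpha> - 1)) *\<^sub>R exp (- ((1 - p) * of_real t))) / of_real (Gamma \<alpha>) \<partial>lborel)"
    unfolding integral_gamma_distribution[OF \<alpha> borel_measurable_continuous_onI[OF continuous_on_exp[OF continuous_on_mult_left[OF continuous_on_of_real_id]]]]
    by (intro Bochner_Integration.integral_cong)
       (auto simp: scaleR_conv_of_real exp_diff exp_minus exp_of_real[symmetric] field_simps)
  also have "\<dots> = exp (- (of_real \<alpha> * Ln (1 - p)))"
    using laplace_gamma_kernel[OF \<alpha>, of "1 - p"] p Gamma_real_pos[OF \<alpha>] by simp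
  finally show ?thesis .
qed

lemma char_gamma_distribution:
  assumes "\<alpha> > 0"
  shows "char (gamma_distribution \<alpha>) u = exp (- (of_real \<alpha> * Ln (1 - \<i> * of_real u)))"
  using laplace_gamma_distribution[OF assms, of "\<i> * of_real u"] by (simp add: char_def mult_ac)

section \<open>The classical exponent\<close>

text \<open>
  Needed for Fubini's theorem: a Levy measure is finite outside every neighbourhood of \<open>0\<close>
  and does not charge \<open>0\<close>.
\<close>

lemma sigma_finite_levy_measure:
  assumes "levy_measure \<rho>"
  shows "sigma_finite_measure \<rho>"
proof
  have [measurable_cong, simp]: "sets \<rho> = sets borel" and zero: "emeasure \<rho> {0} = 0"
    and fin: "(\<integral>\<^sup>+t. ennreal (min 1 (t\<^sup>2)) \<partial>\<rho>) < \<infinity>"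
    using assms by (auto simp: levy_measure_def)
  have [simp]: "space \<rho> = UNIV" using sets_eq_imp_space_eq[of \<rho> borel] by simp
  let ?A = "\<lambda>n::nat. {t::real. inverse (real (Suc n)) \<le> min 1 (t\<^sup>2)}"
  have [measurable]: "?A n \<in> sets borel" for n by measurable
  have "emeasure \<rho> (?A n) < \<infinity>" for n
  proof -
    have "emeasure \<rho> (?A n) = (\<integral>\<^sup>+t. indicator (?A n) t \<partial>\<rho>)" by simp
    also have "\<dots> \<le> (\<integral>\<^sup>+t. ennreal (real (Suc n)) * ennreal (min 1 (t\<^sup>2)) \<partial>\<rho>)"
    proof (rule nn_integral_mono)
      fix t
      show "indicator (?A n) t \<le> ennreal (real (Suc n)) * ennreal (min 1 (t\<^sup>2))"
      proof (cases "t \<in> ?A n")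
        case True
        hence "1 \<le> real (Suc n) * min 1 (t\<^sup>2)"
          using mult_left_mono[of "inverse (real (Suc n))" "min 1 (t\<^sup>2)" "real (Suc n)"]
          by (simp del: of_nat_Suc)
        hence "1 \<le> ennreal (real (Suc n) * min 1 (t\<^sup>2))"
          by (metis ennreal_1 ennreal_leI)
        thus ?thesis using True by (simp add: ennreal_mult' del: of_nat_Suc)
      qed simp
    qed
    also have "\<dots> = ennreal (real (Suc n)) * (\<integral>\<^sup>+t. ennreal (min 1 (t\<^sup>2)) \<partial>\<rho>)"
      by (intro nn_integral_cmult) measurable
    also have "\<dots> < \<infinity>" using fin by (simp add: ennreal_mult_less_top del: of_nat_Suc)
    finally show ?thesis .
  qed
  moreover have "(\<Union>n. ?A n) \<union> {0} = UNIV"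
  proof -
    have "\<exists>n. inverse (real (Suc n)) \<le> min 1 (t\<^sup>2)" if "t \<noteq> 0" for t :: real
      using reals_Archimedean[of "min 1 (t\<^sup>2)"] that by (auto intro: less_imp_le)
    thus ?thesis by auto
  qed
  ultimately show "\<exists>A. countable A \<and> A \<subseteq> sets \<rho> \<and> \<Union>A = space \<rho> \<and> (\<forall>a\<in>A. emeasure \<rho> a \<noteq> \<infinity>)"
    using zero by (intro exI[of _ "insert {0} (range ?A)"]) (auto simp: less_top[symmetric])
qed

definition levy_kernel :: "real \<Rightarrow> real \<Rightarrow> complex" where
  "levy_kernel u t = exp (\<i> * of_real u * of_real t) - 1 - \<i> * of_real u * of_real t * indicator {-1..1} t"

text \<open>
  For \<open>|t| \<le> 1\<close> this is the second-order Taylor estimate, for \<open>|t| > 1\<close> the trivial bound by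
  \<open>2\<close>.
\<close>

lemma levy_kernel_bound: "cmod (levy_kernel u t) \<le> (2 + u\<^sup>2) * min 1 (t\<^sup>2)"
proof (cases "t \<in> {-1..1}")
  case True
  have "levy_kernel u t = iexp (u * t) - (\<Sum>k\<le>1. (\<i> * (u * t)) ^ k / fact k)"
    using True by (simp add: levy_kernel_def mult_ac)
  hence "cmod (levy_kernel u t) \<le> \<bar>u * t\<bar> ^ 2 / 2"
    using iexp_approx1[of "u * t" 1] by (simp add: numeral_2_eq_2)
  also have "\<dots> = u\<^sup>2 * t\<^sup>2 / 2" by (simp add: power_mult_distrib abs_mult)
  also have "\<dots> \<le> (2 + u\<^sup>2) * t\<^sup>2" by (simp add: algebra_simps)
  also have "t\<^sup>2 = min 1 (t\<^sup>2)" using True abs_square_le_1[of t] by (simp add: abs_le_iff)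
  finally show ?thesis .
next
  case False
  hence "1 \<le> t\<^sup>2" by (auto simp: abs_le_square_iff[of 1 t, simplified, symmetric] abs_le_iff)
  have "cmod (levy_kernel u t) \<le> cmod (exp (\<i> * of_real (u * t))) + 1"
    using False norm_triangle_ineq4[of "exp (\<i> * of_real (u * t))" 1] by (simp add: levy_kernel_def mult_ac)
  also have "\<dots> \<le> (2 + u\<^sup>2) * min 1 (t\<^sup>2)" using \<open>1 \<le> t\<^sup>2\<close> by (simp add: min_absorb1)
  finally show ?thesis .
qed

lemma measurable_levy_kernel [measurable]: "(\<lambda>(x, t). levy_kernel (c * x) t) \<in> borel_measurable (borel \<Otimes>\<^sub>M borel)"
  unfolding levy_kernel_def by measurable

lemma measurable_levy_kernel_fixed [measurable]: "levy_kernel u \<in> borel_measurable borel"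
  unfolding levy_kernel_def by measurable

lemma integrable_levy_bound:
  assumes "levy_measure \<rho>"
  shows "integrable \<rho> (\<lambda>t. min 1 (t\<^sup>2))"
proof -
  have [measurable_cong]: "sets \<rho> = sets borel" using assms by (simp add: levy_measure_def)
  show ?thesis
    using assms by (intro integrableI_nonneg) (auto simp: levy_measure_def)
qed

definition levy_exponent :: "real \<Rightarrow> real measure \<Rightarrow> real \<Rightarrow> real \<Rightarrow> complex" where
  "levy_exponent a \<rho> \<eta> u = \<i> * of_real \<eta> * of_real u - of_real a * (of_real u)\<^sup>2 / 2 + (\<integral>t. levy_kernel u t \<partial>\<rho>)"

lemma continuous_on_levy_exponent:
  assumes \<rho>: "levy_measure \<rho>"
  shows "continuous_on UNIV (levy_exponent a \<rho> \<eta>)"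
proof -
  have [measurable_cong]: "sets \<rho> = sets borel" using \<rho> by (simp add: levy_measure_def)
  have "continuous_on UNIV (\<lambda>u. \<integral>t. levy_kernel u t \<partial>\<rho>)"
  proof (rule continuous_on_integral_dominated)
    fix u :: real
    show "\<exists>r>0. \<exists>g. integrable \<rho> g \<and> (\<forall>w\<in>ball u r \<inter> UNIV. \<forall>t\<in>space \<rho>. norm (levy_kernel w t) \<le> g t)"
    proof (intro exI conjI ballI)
      show "integrable \<rho> (\<lambda>t. (2 + (\<bar>u\<bar> + 1)\<^sup>2) * min 1 (t\<^sup>2))"
        using integrable_levy_bound[OF \<rho>] by (rule integrable_mult_right)
      fix w t assume "w \<in> ball u 1 \<inter> (UNIV :: real set)"
      hence "\<bar>w\<bar> \<le> \<bar>\<bar>u\<bar> + 1\<bar>" by (auto simp: dist_real_def)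
      hence "w\<^sup>2 \<le> (\<bar>u\<bar> + 1)\<^sup>2" by (simp only: abs_le_square_iff)
      hence "(2 + w\<^sup>2) * min 1 (t\<^sup>2) \<le> (2 + (\<bar>u\<bar> + 1)\<^sup>2) * min 1 (t\<^sup>2)"
        by (intro mult_right_mono) auto
      thus "norm (levy_kernel w t) \<le> (2 + (\<bar>u\<bar> + 1)\<^sup>2) * min 1 (t\<^sup>2)"
        using levy_kernel_bound[of w t] by linarith
    qed simp
  next
    fix t show "continuous_on UNIV (\<lambda>u. levy_kernel u t)"
      unfolding levy_kernel_def by (intro continuous_intros)
  qed measurable
  thus ?thesis unfolding levy_exponent_def by (intro continuous_intros) auto
qed

lemma levy_exponent_0: "levy_exponent a \<rho> \<eta> 0 = 0"
  by (simp add: levy_exponent_def levy_kernel_def)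

text \<open>
  A continuous function with values in the discrete set \<open>2 \<pi> \<i> \<int>\<close> is constant.
\<close>

lemma continuous_logarithm_unique:
  fixes d :: "real \<Rightarrow> complex"
  assumes cont: "continuous_on UNIV d" and "d 0 = 0" and one: "\<And>u. exp (d u) = 1"
  shows "d u = 0"
proof -
  have "d constant_on UNIV"
  proof (rule continuous_discrete_range_constant[OF _ cont])
    fix x
    show "\<exists>e>0. \<forall>y. y \<in> UNIV \<and> d y \<noteq> d x \<longrightarrow> e \<le> norm (d y - d x)"
    proof (intro exI[of _ 1] conjI allI impI)
      fix y assume y: "y \<in> UNIV \<and> d y \<noteq> d x"
      have "exp (d y - d x) = 1" using one by (simp add: exp_diff)
      then obtain n :: int where n: "Re (d y - d x) = 0" "Im (d y - d x) = of_int (2 * n) * pi"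
        unfolding exp_eq_1 by auto
      have "n \<noteq> 0"
      proof
        assume "n = 0"
        with n have "d y - d x = 0" by (simp add: complex_eq_iff)
        with y show False by simp
      qed
      hence "1 \<le> \<bar>of_int (2 * n)::real\<bar>" by linarith
      moreover have "1 \<le> pi" using pi_ge_two by linarith
      ultimately have "1 * 1 \<le> \<bar>of_int (2 * n)\<bar> * pi" by (intro mult_mono) auto
      also have "\<dots> = \<bar>Im (d y - d x)\<bar>" unfolding n(2) abs_mult by simp
      also have "\<dots> \<le> norm (d y - d x)" by (rule abs_Im_le_cmod)
      finally show "1 \<le> norm (d y - d x)" by simp
    qed simp
  qed simp
  thus ?thesis using assms(2) unfolding constant_on_def by (metis UNIV_I)
qed

text \<open>
  The characteristic function determines the exponent: the two sides are continuous logarithms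
  of it which both vanish at \<open>0\<close>.
\<close>

lemma levy_exponent_gamma:
  assumes \<alpha>: "\<alpha> > 0" and trip: "has_characteristic_triplet (gamma_distribution \<alpha>) a \<rho> \<eta>"
  shows "levy_exponent a \<rho> \<eta> u = - (of_real \<alpha> * Ln (1 - \<i> * of_real u))"
proof -
  have \<rho>: "levy_measure \<rho>" using trip by (simp add: has_characteristic_triplet_def)
  have ch: "char (gamma_distribution \<alpha>) u = exp (levy_exponent a \<rho> \<eta> u)" for u
    using trip by (simp add: has_characteristic_triplet_def levy_exponent_def levy_kernel_def)
  let ?d = "\<lambda>u. levy_exponent a \<rho> \<eta> u + of_real \<alpha> * Ln (1 - \<i> * of_real u)"
  have "?d u = 0"
  proof (rule continuous_logarithm_unique[where d = ?d])
    show "continuous_on UNIV ?d"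
      by (intro continuous_intros continuous_on_levy_exponent[OF \<rho>]) (auto simp: complex_nonpos_Reals_iff)
    show "exp (?d u) = 1" for u
      using ch[of u] char_gamma_distribution[OF \<alpha>, of u] by (simp add: exp_add exp_minus field_simps)
  qed (simp add: levy_exponent_0)
  thus ?thesis by (simp add: add_eq_0_iff)
qed

section \<open>The free cumulant transform\<close>

lemma exponential_weight:
  "indicator {0..} t * t powr (1 - 1) * exp (- t) / Gamma 1 = indicator {0<..} t * exp (- t :: real)"
  by (auto simp: indicator_def)

lemma integral_exponential:
  fixes f :: "real \<Rightarrow> 'a::{banach,second_countable_topology}"
  assumes "f \<in> borel_measurable borel"
  shows "(\<integral>t. f t \<partial>gamma_distribution 1) = (\<integral>t. (indicator {0<..} t * exp (- t)) *\<^sub>R f t \<partial>lborel)"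
  using integral_gamma_distribution[OF zero_less_one assms] unfolding exponential_weight .

lemma integrable_exponential:
  fixes f :: "real \<Rightarrow> 'a::{banach,second_countable_topology}"
  assumes "f \<in> borel_measurable borel"
  shows "integrable (gamma_distribution 1) f \<longleftrightarrow>
    integrable lborel (\<lambda>t. (indicator {0<..} t * exp (- t)) *\<^sub>R f t)"
  using integrable_gamma_distribution[OF zero_less_one assms] unfolding exponential_weight .

lemma exponential_moment:
  assumes "k \<ge> 1"
  shows "integrable (gamma_distribution 1) (\<lambda>x. x ^ k)"
    and "(\<integral>x. x ^ k \<partial>gamma_distribution 1) = fact k"
proof -
  have eq: "(indicator {0<..} t * exp (- t)) *\<^sub>R t ^ k =
      indicator {0..} t * t powr (real (k + 1) - 1) * exp (- (1 * t))" for t :: real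
    using assms by (cases "t = 0") (auto simp: indicator_def powr_realpow)
  have *: "has_bochner_integral lborel (\<lambda>t. (indicator {0<..} t * exp (- t)) *\<^sub>R t ^ k) (fact k)"
    using has_bochner_integral_gamma_scaled[of "real (k + 1)" 1] Gamma_fact[of k, where 'a = real]
    unfolding eq by (simp add: add.commute)
  show "integrable (gamma_distribution 1) (\<lambda>x. x ^ k)"
    using * by (subst integrable_exponential) (auto simp: has_bochner_integral_iff)
  show "(\<integral>x. x ^ k \<partial>gamma_distribution 1) = fact k"
    using * by (subst integral_exponential) (auto simp: has_bochner_integral_iff)
qed

interpretation exponential: prob_space "gamma_distribution 1"
  by (rule prob_space_gamma_distribution) simp

text \<open>
  The kernel of the free cumulant transform is the average of the classical Levy--Khintchine
  kernel under an exponentially distributed dilation.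
\<close>

lemma integral_levy_kernel_exponential:
  "(\<integral>x. levy_kernel (y * x) t \<partial>gamma_distribution 1) =
    1 / (1 - of_real t * (\<i> * of_real y)) - 1 - of_real t * (\<i> * of_real y) * indicator {-1..1} t"
proof -
  let ?p = "of_real t * (\<i> * of_real y)"
  have int1: "integrable (gamma_distribution 1) (\<lambda>x. exp (?p * of_real x))"
    by (rule exponential.integrable_const_bound[where B = 1]) (auto simp: norm_exp_eq_Re)
  have int2: "integrable (gamma_distribution 1) (\<lambda>x. complex_of_real x)"
    using exponential_moment(1)[of 1] by simp
  have "(\<integral>x. levy_kernel (y * x) t \<partial>gamma_distribution 1) =
      (\<integral>x. exp (?p * of_real x) - 1 - (?p * indicator {-1..1} t) * of_real x \<partial>gamma_distribution 1)"
    by (simp add: levy_kernel_def mult_ac)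
  also have "\<dots> = (\<integral>x. exp (?p * of_real x) \<partial>gamma_distribution 1) - 1
      - (?p * indicator {-1..1} t) * (\<integral>x. of_real x \<partial>gamma_distribution 1)"
    using int1 int2 exponential.prob_space by simp
  also have "(\<integral>x. complex_of_real x \<partial>gamma_distribution 1) = 1"
    using exponential_moment(2)[of 1] by simp
  also have "(\<integral>x. exp (?p * of_real x) \<partial>gamma_distribution 1) = exp (- (of_real 1 * Ln (1 - ?p)))"
    by (rule laplace_gamma_distribution) auto
  also have "\<dots> = 1 / (1 - ?p)"
    by (simp add: exp_minus exp_Ln complex_eq_iff inverse_eq_divide)
  finally show ?thesis by simp
qed

lemma integrable_levy_kernel_pair:
  assumes \<rho>: "levy_measure \<rho>"
  shows "integrable (gamma_distribution 1 \<Otimes>\<^sub>M \<rho>) (\<lambda>(x, t). levy_kernel (y * x) t)"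
proof -
  have [measurable_cong, simp]: "sets \<rho> = sets borel" using \<rho> by (simp add: levy_measure_def)
  interpret \<rho>: sigma_finite_measure \<rho> by (rule sigma_finite_levy_measure[OF \<rho>])
  interpret P: pair_sigma_finite "gamma_distribution 1" \<rho> ..
  have h: "integrable (gamma_distribution 1) (\<lambda>x. 2 + y\<^sup>2 * x\<^sup>2)"
    using exponential_moment(1)[of 2] by simp
  have k: "integrable \<rho> (\<lambda>t. min 1 (t\<^sup>2))" by (rule integrable_levy_bound[OF \<rho>])
  have "integrable (gamma_distribution 1 \<Otimes>\<^sub>M \<rho>) (\<lambda>(x, t). (2 + y\<^sup>2 * x\<^sup>2) * min 1 (t\<^sup>2))"
  proof (rule P.Fubini_integrable)
    show "integrable (gamma_distribution 1)
        (\<lambda>x. \<integral>t. norm (case (x, t) of (x, t) \<Rightarrow> (2 + y\<^sup>2 * x\<^sup>2) * min 1 (t\<^sup>2)) \<partial>\<rho>)"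
      using h by (simp add: abs_mult)
  qed (use k in auto)
  thus ?thesis
  proof (rule Bochner_Integration.integrable_bound)
    show "(\<lambda>(x, t). levy_kernel (y * x) t) \<in> borel_measurable (gamma_distribution 1 \<Otimes>\<^sub>M \<rho>)"
      by measurable
    show "AE p in gamma_distribution 1 \<Otimes>\<^sub>M \<rho>.
        norm (case p of (x, t) \<Rightarrow> levy_kernel (y * x) t) \<le> norm (case p of (x, t) \<Rightarrow> (2 + y\<^sup>2 * x\<^sup>2) * min 1 (t\<^sup>2))"
    proof (rule AE_I2)
      fix p :: "real \<times> real"
      show "norm (case p of (x, t) \<Rightarrow> levy_kernel (y * x) t) \<le> norm (case p of (x, t) \<Rightarrow> (2 + y\<^sup>2 * x\<^sup>2) * min 1 (t\<^sup>2))"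
        using levy_kernel_bound[of "y * fst p" "snd p"]
        by (cases p) (simp add: abs_mult power_mult_distrib)
    qed
  qed
qed

text \<open>
  The Barndorff-Nielsen--Thorbjoernsen formula: on the imaginary axis the free cumulant
  transform with a given triplet is an exponential average of the classical exponent with the same
  triplet. The drift term is preserved because the exponential law has mean \<open>1\<close>, and the factor
  \<open>1 / 2\<close> of the Gaussian term disappears because its second moment is \<open>2\<close>.
\<close>

lemma integral_levy_exponent_exponential:
  assumes \<rho>: "levy_measure \<rho>"
  shows "(\<integral>x. levy_exponent a \<rho> \<eta> (y * x) \<partial>gamma_distribution 1) =
    of_real \<eta> * (\<i> * of_real y) + of_real a * (\<i> * of_real y)\<^sup>2 +
    (CLINT t|\<rho>. 1 / (1 - of_real t * (\<i> * of_real y)) - 1 - of_real t * (\<i> * of_real y) * indicator {-1..1} t)"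
proof -
  have [measurable_cong, simp]: "sets \<rho> = sets borel" using \<rho> by (simp add: levy_measure_def)
  interpret \<rho>: sigma_finite_measure \<rho> by (rule sigma_finite_levy_measure[OF \<rho>])
  interpret P: pair_sigma_finite "gamma_distribution 1" \<rho> ..
  let ?E = "gamma_distribution 1"
  note int = integrable_levy_kernel_pair[OF \<rho>, of y]
  have i1: "integrable ?E (\<lambda>x. complex_of_real x)" "(\<integral>x. complex_of_real x \<partial>?E) = 1"
    using exponential_moment[of 1] by simp_all
  have i2: "integrable ?E (\<lambda>x. complex_of_real (x\<^sup>2))" "(\<integral>x. complex_of_real (x\<^sup>2) \<partial>?E) = 2"
    using exponential_moment[of 2] by (simp_all only: integrable_of_real integral_of_real) simp
  have i3: "integrable ?E (\<lambda>x. \<integral>t. levy_kernel (y * x) t \<partial>\<rho>)"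
    using P.integrable_fst[OF int] by simp
  have "(\<integral>x. levy_exponent a \<rho> \<eta> (y * x) \<partial>?E) =
      (\<integral>x. (\<i> * of_real \<eta> * of_real y) * complex_of_real x - (of_real a * (of_real y)\<^sup>2 / 2) * complex_of_real (x\<^sup>2)
        + (\<integral>t. levy_kernel (y * x) t \<partial>\<rho>) \<partial>?E)"
    by (intro Bochner_Integration.integral_cong) (auto simp: levy_exponent_def power_mult_distrib)
  also have "\<dots> = (\<i> * of_real \<eta> * of_real y) * 1 - (of_real a * (of_real y)\<^sup>2 / 2) * 2
      + (\<integral>x. (\<integral>t. levy_kernel (y * x) t \<partial>\<rho>) \<partial>?E)"
    unfolding i1(2)[symmetric] i2(2)[symmetric]
    using i1(1) i2(1) i3 by (simp del: of_real_power)
  also have "(\<integral>x. (\<integral>t. levy_kernel (y * x) t \<partial>\<rho>) \<partial>?E) = (\<integral>t. (\<integral>x. levy_kernel (y * x) t \<partial>?E) \<partial>\<rho>)"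
    by (rule P.Fubini_integral[OF int, symmetric])
  also have "\<dots> = (CLINT t|\<rho>. 1 / (1 - of_real t * (\<i> * of_real y)) - 1 - of_real t * (\<i> * of_real y) * indicator {-1..1} t)"
    by (simp only: integral_levy_kernel_exponential)
  finally show ?thesis by (simp add: power_mult_distrib mult_ac)
qed

lemma cmod_Ln_le:
  fixes x y :: real
  shows "cmod (Ln (1 - \<i> * of_real y * of_real x)) \<le> \<bar>y\<bar> * \<bar>x\<bar> + pi"
proof -
  let ?w = "1 - \<i> * of_real y * of_real x"
  have w: "?w \<noteq> 0" by (simp add: complex_eq_iff)
  have "1 \<le> cmod ?w" using abs_Re_le_cmod[of ?w] by simp
  have "cmod ?w \<le> 1 + \<bar>y\<bar> * \<bar>x\<bar>"
    using norm_triangle_ineq4[of 1 "\<i> * of_real y * of_real x"] by (simp add: norm_mult)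
  have "cmod (Ln ?w) \<le> \<bar>Re (Ln ?w)\<bar> + \<bar>Im (Ln ?w)\<bar>" by (rule cmod_le)
  also have "Re (Ln ?w) = ln (cmod ?w)" using w by simp
  also have "\<bar>ln (cmod ?w)\<bar> \<le> \<bar>y\<bar> * \<bar>x\<bar>"
  proof -
    have "ln (cmod ?w) \<le> cmod ?w - 1" using \<open>1 \<le> cmod ?w\<close> by (intro ln_le_minus_one) linarith
    moreover have "0 \<le> ln (cmod ?w)" using \<open>1 \<le> cmod ?w\<close> by (rule ln_ge_zero)
    ultimately show ?thesis using \<open>cmod ?w \<le> _\<close> by linarith
  qed
  also have "\<bar>Im (Ln ?w)\<bar> \<le> pi" using mpi_less_Im_Ln[OF w] Im_Ln_le_pi[OF w] by simp
  finally show ?thesis by simp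
qed

lemma continuous_on_Ln_line: "continuous_on S (\<lambda>x. Ln (1 - \<i> * of_real y * complex_of_real x))"
  by (intro continuous_intros) (auto simp: complex_nonpos_Reals_iff)

lemma line_ne_0: "1 - \<i> * of_real y * complex_of_real x \<noteq> 0"
  by (simp add: complex_eq_iff)

lemma integrable_Ln_exponential:
  "integrable (gamma_distribution 1) (\<lambda>x. Ln (1 - \<i> * of_real y * complex_of_real x))"
proof (rule Bochner_Integration.integrable_bound)
  show "integrable (gamma_distribution 1) (\<lambda>x. \<bar>y\<bar> * \<bar>x\<bar> + pi)"
    using integrable_abs[OF exponential_moment(1)[of 1]] by simp
  show "(\<lambda>x. Ln (1 - \<i> * of_real y * complex_of_real x)) \<in> borel_measurable (gamma_distribution 1)"
    using borel_measurable_continuous_onI[OF continuous_on_Ln_line] by simp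
  show "AE x in gamma_distribution 1. norm (Ln (1 - \<i> * of_real y * complex_of_real x)) \<le> norm (\<bar>y\<bar> * \<bar>x\<bar> + pi)"
    using cmod_Ln_le by (intro AE_I2) (simp add: abs_of_nonneg)
qed

lemma continuous_on_resolvent_line: "continuous_on S (\<lambda>x. \<i> * of_real y / (1 - \<i> * of_real y * complex_of_real x))"
  using line_ne_0 by (intro continuous_intros) auto

lemma integrable_resolvent_exponential:
  "integrable (gamma_distribution 1) (\<lambda>x. \<i> * of_real y / (1 - \<i> * of_real y * complex_of_real x))"
proof (rule exponential.integrable_const_bound[where B = "\<bar>y\<bar>"])
  show "(\<lambda>x. \<i> * of_real y / (1 - \<i> * of_real y * complex_of_real x)) \<in> borel_measurable (gamma_distribution 1)"
    using borel_measurable_continuous_onI[OF continuous_on_resolvent_line] by simp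
  show "AE x in gamma_distribution 1. norm (\<i> * of_real y / (1 - \<i> * of_real y * complex_of_real x)) \<le> \<bar>y\<bar>"
  proof (rule AE_I2)
    fix x :: real
    have "1 \<le> cmod (1 - \<i> * of_real y * complex_of_real x)"
      using abs_Re_le_cmod[of "1 - \<i> * of_real y * complex_of_real x"] by simp
    hence "\<bar>y\<bar> / cmod (1 - \<i> * of_real y * complex_of_real x) \<le> \<bar>y\<bar> / 1" by (intro divide_left_mono) auto
    thus "norm (\<i> * of_real y / (1 - \<i> * of_real y * complex_of_real x)) \<le> \<bar>y\<bar>"
      by (simp add: norm_divide norm_mult)
  qed
qed

text \<open>
  Integration by parts. The boundary terms vanish, at \<open>0\<close> because \<open>Ln 1 = 0\<close> and at infinity
  because the logarithm grows at most linearly.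
\<close>

lemma integral_Ln_exponential:
  "(\<integral>x. Ln (1 - \<i> * of_real y * complex_of_real x) \<partial>gamma_distribution 1) =
    - (\<integral>x. \<i> * of_real y / (1 - \<i> * of_real y * complex_of_real x) \<partial>gamma_distribution 1)"
proof -
  let ?E = "gamma_distribution 1"
  let ?L = "\<lambda>x. Ln (1 - \<i> * of_real y * complex_of_real x)"
  let ?R = "\<lambda>x. \<i> * of_real y / (1 - \<i> * of_real y * complex_of_real x)"
  let ?F = "\<lambda>x::real. exp (- x) *\<^sub>R ?L x"
  let ?f = "\<lambda>x::real. exp (- x) *\<^sub>R (- ?R x - ?L x)"
  have meas: "(\<lambda>x. - ?R x - ?L x) \<in> borel_measurable borel"
    by (intro borel_measurable_continuous_onI continuous_on_diff continuous_on_minus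
        continuous_on_resolvent_line continuous_on_Ln_line)
  have int: "integrable ?E (\<lambda>x. - ?R x - ?L x)"
    using integrable_resolvent_exponential integrable_Ln_exponential by auto
  have bound: "norm (?F x) \<le> (\<bar>y\<bar> * \<bar>x\<bar> + pi) / exp x" for x
    using cmod_Ln_le[of y x] by (simp add: exp_minus divide_inverse mult_ac)
  have "(LBINT x=0..\<infinity>. ?f x) = 0 - 0"
  proof (rule interval_integral_FTC_integrable[where F = ?F])
    fix x :: real
    have "((\<lambda>x. exp (- x) *\<^sub>R ?L x) has_vector_derivative
        (exp (- x) *\<^sub>R (- \<i> * of_real y / (1 - \<i> * of_real y * of_real x)) + (- exp (- x)) *\<^sub>R ?L x)) (at x)"
    proof (rule has_vector_derivative_scaleR)
      show "((\<lambda>x. exp (- x)) has_field_derivative - exp (- x)) (at x)"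
        by (auto intro!: derivative_eq_intros)
      have "((\<lambda>w. Ln (1 - \<i> * of_real y * w)) has_field_derivative
          (- \<i> * of_real y / (1 - \<i> * of_real y * of_real x))) (at (of_real x))"
        by (auto intro!: derivative_eq_intros simp: complex_nonpos_Reals_iff divide_inverse)
      from has_vector_derivative_real_field[OF this]
      show "(?L has_vector_derivative (- \<i> * of_real y / (1 - \<i> * of_real y * of_real x))) (at x)" .
    qed
    thus "(?F has_vector_derivative ?f x) (at x)" by (simp add: scaleR_diff_right)
    have "continuous_on UNIV ?f"
      by (intro continuous_on_scaleR continuous_on_diff continuous_on_minus continuous_on_exp
          continuous_on_id continuous_on_resolvent_line continuous_on_Ln_line)
    thus "isCont ?f x" by (simp only: continuous_on_eq_continuous_at[OF open_UNIV] UNIV_I ball_simps)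
  next
    show "set_integrable lborel (einterval 0 \<infinity>) ?f"
    proof -
      have e: "einterval 0 \<infinity> = {0<..}" by (auto simp: einterval_def)
      show ?thesis
        using int unfolding integrable_exponential[OF meas] set_integrable_def e scaleR_scaleR .
    qed
    have "continuous_on UNIV ?F"
      by (intro continuous_on_scaleR continuous_on_minus continuous_on_exp
          continuous_on_id continuous_on_Ln_line)
    hence "(?F \<longlongrightarrow> ?F 0) (at 0)"
      unfolding continuous_on_def by (rule bspec) (rule UNIV_I)
    moreover have "?F 0 = 0" by simp
    ultimately have "(?F \<longlongrightarrow> 0) (at 0)" by (simp only:)
    hence "(?F \<longlongrightarrow> 0) (at_right 0)" by (rule Lim_at_imp_Lim_at_within)
    thus "((?F \<circ> real_of_ereal) \<longlongrightarrow> 0) (at_right 0)"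
      unfolding zero_ereal_def ereal_tendsto_simps .
    have "(?F \<longlongrightarrow> 0) at_top"
    proof (rule Lim_null_comparison)
      show "\<forall>\<^sub>F x in at_top. norm (?F x) \<le> \<bar>y\<bar> * (x ^ 1 / exp x) + pi * (x ^ 0 / exp x)"
        using eventually_ge_at_top[of 0]
      proof eventually_elim
        case (elim x)
        thus ?case using bound[of x] by (simp add: add_divide_distrib)
      qed
      have "((\<lambda>x. \<bar>y\<bar> * (x ^ 1 / exp x) + pi * (x ^ 0 / exp x)) \<longlongrightarrow> \<bar>y\<bar> * 0 + pi * 0) at_top"
        by (intro tendsto_intros tendsto_power_div_exp_0)
      thus "((\<lambda>x. \<bar>y\<bar> * (x ^ 1 / exp x) + pi * (x ^ 0 / exp x)) \<longlongrightarrow> 0) at_top" by simp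
    qed
    thus "((?F \<circ> real_of_ereal) \<longlongrightarrow> 0) (at_left \<infinity>)"
      unfolding ereal_tendsto_simps .
  qed simp
  moreover have "(LBINT x=0..\<infinity>. ?f x) = (\<integral>x. - ?R x - ?L x \<partial>?E)"
    unfolding integral_exponential[OF meas] zero_ereal_def interval_integral_to_infinity_eq set_lebesgue_integral_def
    by (simp only: scaleR_scaleR)
  moreover have "(\<integral>x. - ?R x - ?L x \<partial>?E) = - (\<integral>x. ?R x \<partial>?E) - (\<integral>x. ?L x \<partial>?E)"
    by (simp only: Bochner_Integration.integral_minus
        Bochner_Integration.integral_diff[OF Bochner_Integration.integrable_minus[OF
          integrable_resolvent_exponential] integrable_Ln_exponential])
  ultimately have "- (\<integral>x. ?R x \<partial>?E) - (\<integral>x. ?L x \<partial>?E) = 0" by (simp only: diff_self)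
  thus ?thesis by (simp only: right_minus_eq)
qed

text \<open>
  From \<open>w / (w - x) = 1 + x / (w - x)\<close>: the constant \<open>\<alpha>\<close> in \<open>H_fun\<close> and its density
  \<open>t exp (- t)\<close> both arise in this way.
\<close>

lemma H_fun_exponential:
  assumes y: "y > 0"
  shows "H_fun \<alpha> (\<i> * of_real y) = \<i> * of_real y *
    (1 + of_real \<alpha> * (\<integral>x. 1 / (\<i> * of_real y - of_real x) \<partial>gamma_distribution 1))"
proof -
  let ?w = "\<i> * of_real y" and ?E = "gamma_distribution 1"
  have ne: "?w - of_real x \<noteq> 0" for x using y by (simp add: complex_eq_iff)
  have m1: "(\<lambda>x. 1 / (?w - of_real x)) \<in> borel_measurable borel"
    and m2: "(\<lambda>x. of_real x / (?w - of_real x)) \<in> borel_measurable borel" by measurable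
  have bd: "cmod (of_real x / (?w - of_real x)) \<le> 1" "cmod (1 / (?w - of_real x)) \<le> 1 / y" for x
    using abs_Re_le_cmod[of "?w - of_real x"] abs_Im_le_cmod[of "?w - of_real x"] y ne[of x]
    by (auto simp: norm_divide divide_simps)
  have i2: "integrable ?E (\<lambda>x. of_real x / (?w - of_real x))"
    using m2 bd by (intro exponential.integrable_const_bound[where B = 1]) auto
  have i1: "integrable ?E (\<lambda>x. 1 / (?w - of_real x))"
    using m1 bd by (intro exponential.integrable_const_bound[where B = "1 / y"]) auto
  have "?w * (\<integral>x. 1 / (?w - of_real x) \<partial>?E) = (\<integral>x. ?w * (1 / (?w - of_real x)) \<partial>?E)"
    by (rule integral_mult_right_zero[symmetric])
  also have "\<dots> = (\<integral>x. 1 + of_real x / (?w - of_real x) \<partial>?E)"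
    using ne by (intro Bochner_Integration.integral_cong) (auto simp: field_simps)
  also have "\<dots> = 1 + (\<integral>x. of_real x / (?w - of_real x) \<partial>?E)"
    using i2 exponential.prob_space by simp
  also have "(\<integral>x. of_real x / (?w - of_real x) \<partial>?E) =
      (CLINT t:{0..}|lborel. of_real (t * exp (- t)) / (?w - of_real t))"
    unfolding integral_exponential[OF m2] set_lebesgue_integral_def
    by (intro Bochner_Integration.integral_cong) (auto simp: indicator_def scaleR_conv_of_real)
  finally have "?w * (\<integral>x. 1 / (?w - of_real x) \<partial>?E) =
      1 + (CLINT t:{0..}|lborel. of_real (t * exp (- t)) / (?w - of_real t))" .
  thus ?thesis unfolding H_fun_def by (simp add: algebra_simps)
qed

text \<open>
  On the imaginary axis the inverse \<open>K\<close> of the Cauchy transform is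
  \<open>K z = (1 + C z) / z\<close>, with \<open>C\<close> computed from the exponent of the Gamma law. At \<open>z = 1 / w\<close> this
  is \<open>H_fun \<alpha> w\<close>.
\<close>

lemma cauchy_transform_free_gamma:
  assumes \<alpha>: "\<alpha> > 0" and \<nu>: "free_gamma_distribution \<alpha> \<nu>"
  obtains M where "M > 0"
    "\<And>y. y > M \<Longrightarrow> Im (H_fun \<alpha> (\<i> * of_real y)) > 0"
    "\<And>y. y > M \<Longrightarrow> cauchy_transform \<nu> (H_fun \<alpha> (\<i> * of_real y)) = 1 / (\<i> * of_real y)"
proof -
  obtain a \<rho> \<eta> where trip: "has_characteristic_triplet (gamma_distribution \<alpha>) a \<rho> \<eta>"
    and free: "has_free_characteristic_triplet \<nu> a \<rho> \<eta>"
    using \<nu> by (auto simp: free_gamma_distribution_def bercovici_pata_def)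
  have \<rho>: "levy_measure \<rho>" using trip by (simp add: has_characteristic_triplet_def)
  let ?C = "\<lambda>z. of_real \<eta> * z + of_real a * z\<^sup>2 +
      (CLINT t|\<rho>. 1 / (1 - of_real t * z) - 1 - of_real t * z * indicator {-1..1} t)"
  obtain \<beta> M K \<beta>' M' where K: "\<beta> > 0" "M > 0" "\<beta>' > 0" "M' > 0"
    and KG: "\<And>z. z \<in> cumulant_domain \<beta> M \<Longrightarrow> K z \<in> truncated_cone \<beta>' M' \<and> cauchy_transform \<nu> (K z) = z"
    and CK: "\<And>z. z \<in> cumulant_domain \<beta> M \<Longrightarrow> ?C z = z * K z - 1"
    using free unfolding has_free_characteristic_triplet_def free_cumulant_transform_def cauchy_right_inverse_def
    by blast
  have main: "Im (H_fun \<alpha> (\<i> * of_real y)) > 0 \<and>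
      cauchy_transform \<nu> (H_fun \<alpha> (\<i> * of_real y)) = 1 / (\<i> * of_real y)" if y: "y > M" for y
  proof -
    have y0: "y > 0" using y K by simp
    \<comment> \<open>The point \<open>z = \<i> u\<close> of the cumulant domain is the reciprocal of \<open>w = \<i> y\<close>.\<close>
    define u where "u = - 1 / y"
    let ?z = "\<i> * complex_of_real u" and ?w = "\<i> * complex_of_real y"
    have wz: "?z = 1 / ?w" "?z * ?w = 1" using y0 by (simp_all add: u_def complex_eq_iff Re_divide Im_divide field_simps)
    have dom: "?z \<in> cumulant_domain \<beta> M"
    proof -
      have "1 / ?z = ?w" using wz y0 by simp
      moreover have "Im ?z < 0" using y0 by (simp add: u_def)
      ultimately show ?thesis using y y0 K by (simp add: cumulant_domain_def truncated_cone_def)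
    qed
    have "?C ?z = (\<integral>x. levy_exponent a \<rho> \<eta> (u * x) \<partial>gamma_distribution 1)"
      by (rule integral_levy_exponent_exponential[OF \<rho>, symmetric])
    also have "\<dots> = (\<integral>x. - of_real \<alpha> * Ln (1 - \<i> * of_real u * of_real x) \<partial>gamma_distribution 1)"
      by (simp add: levy_exponent_gamma[OF \<alpha> trip] mult.assoc)
    also have "\<dots> = - of_real \<alpha> * (\<integral>x. Ln (1 - \<i> * of_real u * of_real x) \<partial>gamma_distribution 1)"
      by (rule integral_mult_right_zero)
    also have "\<dots> = of_real \<alpha> * (\<integral>x. ?z / (1 - ?z * of_real x) \<partial>gamma_distribution 1)"
      unfolding integral_Ln_exponential by simp
    also have "(\<integral>x. ?z / (1 - ?z * of_real x) \<partial>gamma_distribution 1) = (\<integral>x. 1 / (?w - of_real x) \<partial>gamma_distribution 1)"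
    proof (intro Bochner_Integration.integral_cong refl)
      fix x :: real
      have "?w \<noteq> 0" "?w - of_real x \<noteq> 0" using y0 by (auto simp: complex_eq_iff)
      thus "?z / (1 - ?z * of_real x) = 1 / (?w - of_real x)"
        unfolding wz(1) by (simp add: field_simps)
    qed
    finally have C: "?C ?z = of_real \<alpha> * (\<integral>x. 1 / (?w - of_real x) \<partial>gamma_distribution 1)" .
    have "K ?z = ?w * (?z * K ?z)" using wz(2) by (simp add: mult.assoc[symmetric] mult.commute)
    also have "?z * K ?z = 1 + ?C ?z" using CK[OF dom] by simp
    also have "?w * (1 + ?C ?z) = H_fun \<alpha> ?w" unfolding C using H_fun_exponential[OF y0] by simp
    finally have "K ?z = H_fun \<alpha> ?w" .
    thus ?thesis using KG[OF dom] K wz by (simp add: truncated_cone_def)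
  qed
  show ?thesis by (rule that[OF K(2)]) (use main in blast)+
qed

section \<open>The Cauchy transform of the free Gamma distribution\<close>

lemma holomorphic_on_cauchy_transform:
  assumes \<nu>: "real_distribution \<nu>"
  shows "cauchy_transform \<nu> holomorphic_on {z. Im z > 0}"
proof -
  interpret real_distribution \<nu> by fact
  have "open {z. Im z > 0}" by (intro open_Collect_less continuous_intros)
  thus ?thesis
    unfolding cauchy_transform_def[abs_def]
  proof (rule holomorphic_on_integral_dominated)
    fix z assume "z \<in> {z. Im z > 0}"
    hence z: "Im z > 0" by simp
    show "\<exists>r>0. \<exists>g. integrable \<nu> g \<and> (\<forall>w\<in>ball z r \<inter> {z. Im z > 0}. \<forall>t\<in>space \<nu>.
        norm (1 / (w - of_real t)) \<le> g t)"
    proof (intro exI conjI ballI)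
      show "Im z / 2 > 0" using z by simp
      show "integrable \<nu> (\<lambda>_. 2 / Im z)" by simp
      fix w t assume "w \<in> ball z (Im z / 2) \<inter> {z. Im z > 0}"
      hence "cmod (z - w) < Im z / 2" by (simp add: dist_norm)
      hence "Im z / 2 \<le> cmod (w - of_real t)"
        using abs_Im_le_cmod[of "z - w"] abs_Im_le_cmod[of "w - of_real t"] by simp
      hence "1 / cmod (w - of_real t) \<le> 1 / (Im z / 2)" using z by (intro inverse_le) auto
      thus "norm (1 / (w - of_real t)) \<le> 2 / Im z" by (simp add: norm_divide)
    qed
  next
    fix t
    show "(\<lambda>z. 1 / (z - of_real t)) holomorphic_on {z. Im z > 0}"
      by (intro holomorphic_intros) (auto simp: complex_eq_iff)
  qed auto
qed

lemma continuous_on_resolvent_pairing: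
  assumes z: "z \<in> slit_plane"
  shows "continuous_on slit_plane (\<lambda>w. resolvent_pairing w z)"
  unfolding resolvent_pairing_def
proof (rule continuous_on_integral_dominated)
  obtain q where q: "q > 0" "\<And>t. t \<ge> 0 \<Longrightarrow> q \<le> cmod (z - of_real t)"
    using slit_plane_away[OF z] by blast
  fix w assume "w \<in> slit_plane"
  then obtain r where r: "r > 0" "\<And>w' t. w' \<in> ball w r \<Longrightarrow> t \<ge> 0 \<Longrightarrow> r \<le> cmod (w' - of_real t)"
    using slit_plane_locally_away by metis
  show "\<exists>r>0. \<exists>g. integrable gamma2 g \<and> (\<forall>w\<in>ball w r \<inter> slit_plane. \<forall>t\<in>space gamma2.
      norm (1 / ((w - of_real t) * (z - of_real t))) \<le> g t)"
    by (rule exI[of _ r], intro conjI r(1) exI[of _ "\<lambda>_. 1 / (r * q)"])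
       (use r q in \<open>auto simp: space_gamma2 norm_divide norm_mult intro!: inverse_le mult_mono\<close>)
next
  fix t assume "t \<in> space gamma2"
  thus "continuous_on slit_plane (\<lambda>w. 1 / ((w - of_real t) * (z - of_real t)))"
    using slit_plane_ne slit_plane_ne[OF z] by (auto simp: space_gamma2 intro!: continuous_intros)
qed auto

lemma deriv_H_fun:
  assumes w: "w \<in> slit_plane"
  shows "(H_fun \<alpha> has_field_derivative 1 - of_real \<alpha> * resolvent_pairing w w) (at w)"
  unfolding has_field_derivative_iff
proof (rule Lim_transform_within_open)
  have "isCont (\<lambda>u. resolvent_pairing u w) w"
    using continuous_on_resolvent_pairing[OF w] open_slit_plane w
    by (simp add: continuous_on_eq_continuous_at)
  thus "((\<lambda>u. 1 - of_real \<alpha> * resolvent_pairing u w) \<longlongrightarrow> 1 - of_real \<alpha> * resolvent_pairing w w) (at w)"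
    by (intro tendsto_intros) (simp add: isCont_def)
  fix u assume "u \<in> slit_plane" "u \<noteq> w"
  thus "1 - of_real \<alpha> * resolvent_pairing u w = (H_fun \<alpha> u - H_fun \<alpha> w) / (u - w)"
    using H_fun_diff[OF _ w] by simp
qed (use w open_slit_plane in auto)

text \<open>
  At a point of the closed region off the real axis the derivative of \<open>H_fun\<close> does not vanish, so there is
  a local holomorphic inverse. It agrees with \<open>H_inv\<close> on the closed upper half-plane because
  \<open>H_inv\<close> is continuous and \<open>H_fun\<close> is injective near the point.
\<close>

lemma H_inv_local_extension:
  assumes \<alpha>: "\<alpha> > 0" and w: "w \<in> upper_closure \<alpha>" and Im: "Im w > 0"
  obtains r g where "r > 0" "g holomorphic_on ball (H_fun \<alpha> w) r"
    "\<And>z. z \<in> ball (H_fun \<alpha> w) r \<Longrightarrow> g z \<noteq> 0"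
    "\<And>z. z \<in> ball (H_fun \<alpha> w) r \<Longrightarrow> Im z \<ge> 0 \<Longrightarrow> g z = H_inv \<alpha> z"
proof -
  have ws: "w \<in> slit_plane" using w upper_closure_subset by blast
  have "w \<noteq> cnj w" using Im by (auto simp: complex_eq_iff)
  hence "Re (1 - of_real \<alpha> * resolvent_pairing w w) > 0"
    using H_fun_difference_quotient[OF \<alpha> w w] by blast
  hence "1 - of_real \<alpha> * resolvent_pairing w w \<noteq> 0" by (metis less_irrefl zero_complex.sel(1))
  moreover have "deriv (H_fun \<alpha>) w = 1 - of_real \<alpha> * resolvent_pairing w w"
    using deriv_H_fun[OF ws] by (rule DERIV_imp_deriv)
  ultimately have "deriv (H_fun \<alpha>) w \<noteq> 0" by (simp only: not_False_eq_True)
  from has_complex_derivative_locally_injective[OF holomorphic_on_H_fun ws open_slit_plane this]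
  obtain r1 where r1: "r1 > 0" "ball w r1 \<subseteq> slit_plane" "inj_on (H_fun \<alpha>) (ball w r1)" by blast
  have hol: "H_fun \<alpha> holomorphic_on ball w r1"
    using holomorphic_on_H_fun r1(2) by (rule holomorphic_on_subset)
  from holomorphic_has_inverse[OF hol open_ball r1(3)]
  obtain g where g: "g holomorphic_on (H_fun \<alpha> ` ball w r1)"
    "\<And>u. u \<in> ball w r1 \<Longrightarrow> g (H_fun \<alpha> u) = u" by metis
  have "open (H_fun \<alpha> ` ball w r1)" by (rule open_mapping_thm3[OF hol open_ball r1(3)])
  moreover have "H_fun \<alpha> w \<in> H_fun \<alpha> ` ball w r1" using r1(1) by simp
  ultimately obtain r2 where r2: "r2 > 0" "ball (H_fun \<alpha> w) r2 \<subseteq> H_fun \<alpha> ` ball w r1"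
    using open_contains_ball by blast
  have Hw: "Im (H_fun \<alpha> w) \<ge> 0" "H_inv \<alpha> (H_fun \<alpha> w) = w"
    using H_fun_image_closure[OF \<alpha>] H_inv_H_fun[OF \<alpha>] w by blast+
  obtain d where d: "d > 0" "\<And>z. Im z \<ge> 0 \<Longrightarrow> dist z (H_fun \<alpha> w) < d \<Longrightarrow> dist (H_inv \<alpha> z) w < r1"
    using continuous_on_H_inv[OF \<alpha>, unfolded continuous_on_iff, rule_format, of "H_fun \<alpha> w" r1]
      Hw r1(1) by auto
  show ?thesis
  proof (rule that[of "min r2 d" g])
    show "min r2 d > 0" using r2 d by simp
    show "g holomorphic_on ball (H_fun \<alpha> w) (min r2 d)"
      using g(1) by (rule holomorphic_on_subset) (use r2 in auto)
    fix z assume z: "z \<in> ball (H_fun \<alpha> w) (min r2 d)"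
    hence "z \<in> H_fun \<alpha> ` ball w r1" using r2(2) by auto
    hence "g z \<in> ball w r1" using g(2) by auto
    hence "g z \<in> slit_plane" using r1(2) by blast
    thus "g z \<noteq> 0" by (auto simp: slit_plane_def)
    assume "Im z \<ge> 0"
    hence "H_inv \<alpha> z \<in> ball w r1" "H_fun \<alpha> (H_inv \<alpha> z) = z"
      using d(2)[of z] z H_fun_H_inv[OF \<alpha>, of z] by (auto simp: dist_commute)
    thus "g z = H_inv \<alpha> z" using g(2)[of "H_inv \<alpha> z"] by simp
  qed
qed

lemma H_inv_nonzero: "\<alpha> > 0 \<Longrightarrow> Im z \<ge> 0 \<Longrightarrow> H_inv \<alpha> z \<noteq> 0"
  using H_inv_in[of \<alpha> z] by (auto simp: upper_closure_def slit_plane_def)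

lemma upper_half_plane_holomorphic_unique:
  fixes f g :: "complex \<Rightarrow> complex"
  assumes "f holomorphic_on {z. Im z > 0}" "g holomorphic_on {z. Im z > 0}"
    and X: "\<And>n. Im (X n) > 0" "X \<longlonglongrightarrow> l" "Im l > 0" "\<And>n. X n \<noteq> l" "\<And>n. f (X n) = g (X n)"
    and z: "Im z > 0"
  shows "f z = g z"
proof -
  let ?U = "{z. Im z > 0}"
  have "(\<lambda>z. f z - g z) holomorphic_on ?U" using assms by (intro holomorphic_intros)
  moreover have "open ?U" by (intro open_Collect_less continuous_intros)
  moreover have "connected ?U" by (intro convex_connected convex_halfspace_Im_gt)
  moreover have "range X \<subseteq> ?U" "l \<in> ?U" using X by auto
  moreover have "l islimpt range X"
    unfolding islimpt_sequential using X by (intro exI[of _ X]) auto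
  moreover have "f w - g w = 0" if "w \<in> range X" for w using that X by auto
  ultimately have "f z - g z = 0"
    by (rule analytic_continuation) (use z in auto)
  thus ?thesis by simp
qed

text \<open>
  Both sides are holomorphic on the upper half-plane and agree on the image of a half-line
  under the injective map \<open>H_fun\<close>, which has limit points there.
\<close>

lemma cauchy_transform_free_gamma_eq:
  assumes \<alpha>: "\<alpha> > 0" and \<nu>: "real_distribution \<nu>" and free: "free_gamma_distribution \<alpha> \<nu>"
    and z: "Im z > 0"
  shows "cauchy_transform \<nu> z = 1 / H_inv \<alpha> z"
proof -
  obtain M where M: "M > 0" "\<And>y. y > M \<Longrightarrow> Im (H_fun \<alpha> (\<i> * of_real y)) > 0"
    "\<And>y. y > M \<Longrightarrow> cauchy_transform \<nu> (H_fun \<alpha> (\<i> * of_real y)) = 1 / (\<i> * of_real y)"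
    using cauchy_transform_free_gamma[OF \<alpha> free] by blast
  have in_region: "\<i> * of_real y \<in> upper_region \<alpha>" if "y > M" for y
    using Im_H_fun_pos_iff[OF \<alpha>, of "\<i> * of_real y"] M that by auto
  have inv: "H_inv \<alpha> (H_fun \<alpha> (\<i> * of_real y)) = \<i> * of_real y" if "y > M" for y
    using H_inv_H_fun[OF \<alpha>] in_region[OF that] upper_region_subset by blast
  \<comment> \<open>The half-line is sampled along a sequence that converges to one of its points.\<close>
  define Y where "Y n = M + 1 + inverse (real (Suc n))" for n
  have Y: "Y n > M + 1" for n by (simp add: Y_def)
  have YM: "Y n > M" for n using Y[of n] by simp
  have Ylim: "Y \<longlonglongrightarrow> M + 1 + 0" unfolding Y_def by (intro tendsto_intros LIMSEQ_inverse_real_of_nat)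
  let ?l = "\<i> * complex_of_real (M + 1)"
  have l: "?l \<in> slit_plane" using M(1) by (simp add: slit_plane_def)
  show ?thesis
  proof (rule upper_half_plane_holomorphic_unique[where f = "cauchy_transform \<nu>" and g = "\<lambda>z. 1 / H_inv \<alpha> z"
        and X = "\<lambda>n. H_fun \<alpha> (\<i> * of_real (Y n))" and l = "H_fun \<alpha> ?l"])
    show "(\<lambda>z. 1 / H_inv \<alpha> z) holomorphic_on {z. Im z > 0}"
      using holomorphic_on_H_inv[OF \<alpha>] H_inv_nonzero[OF \<alpha>] by (intro holomorphic_intros) (auto simp: less_imp_le)
    have "(\<lambda>n. \<i> * complex_of_real (Y n)) \<longlonglongrightarrow> \<i> * complex_of_real (M + 1 + 0)"
      by (intro tendsto_intros Ylim)
    moreover have "isCont (H_fun \<alpha>) ?l"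
      using holomorphic_on_imp_continuous_on[OF holomorphic_on_H_fun] l open_slit_plane
      by (simp add: continuous_on_eq_continuous_at del: of_real_add)
    ultimately show "(\<lambda>n. H_fun \<alpha> (\<i> * of_real (Y n))) \<longlonglongrightarrow> H_fun \<alpha> ?l"
      by (intro isCont_tendsto_compose[of _ "H_fun \<alpha>"]) auto
    show "H_fun \<alpha> (\<i> * of_real (Y n)) \<noteq> H_fun \<alpha> ?l" for n
    proof
      assume "H_fun \<alpha> (\<i> * of_real (Y n)) = H_fun \<alpha> ?l"
      hence "H_inv \<alpha> (H_fun \<alpha> (\<i> * of_real (Y n))) = H_inv \<alpha> (H_fun \<alpha> ?l)" by (simp only:)
      hence "\<i> * of_real (Y n) = ?l" by (simp only: inv[OF YM] inv[OF less_add_one])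
      thus False using Y[of n] by (simp del: of_real_add)
    qed
    show "cauchy_transform \<nu> (H_fun \<alpha> (\<i> * of_real (Y n))) = 1 / H_inv \<alpha> (H_fun \<alpha> (\<i> * of_real (Y n)))" for n
      using M(3)[OF YM] inv[OF YM] by simp
    show "Im (H_fun \<alpha> ?l) > 0" using M(2)[OF less_add_one] .
    show "Im (H_fun \<alpha> (\<i> * of_real (Y n))) > 0" for n using M(2)[OF YM] .
  qed (use holomorphic_on_cauchy_transform[OF \<nu>] z in auto)
qed

section \<open>The free Gamma density\<close>

theorem theorem3p8:
  fixes \<alpha> :: real and \<nu> :: "real measure" and Q f :: "real \<Rightarrow> real"
  assumes "\<alpha> > 0"
    and "free_gamma_distribution \<alpha> \<nu>"
    and "\<forall>x. Q x = v_fun \<alpha> x / (x\<^sup>2 + (v_fun \<alpha> x)\<^sup>2)"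
    and "\<forall>\<xi>. f \<xi> = (if \<xi> \<le> s_const \<alpha> then 0 else 1 / pi * Q (inv (P_fun \<alpha>) \<xi>))"
  shows "absolutely_continuous lborel \<nu>
    \<and> is_lebesgue_density \<nu> f
    \<and> measure_support \<nu> = {s_const \<alpha>..}
    \<and> real_analytic_on f {s_const \<alpha><..}"
proof -
  note \<alpha> = assms(1)
  have \<nu>: "real_distribution \<nu>"
    using assms(2) by (auto simp: free_gamma_distribution_def bercovici_pata_def has_free_characteristic_triplet_def)
  let ?x = "inv (P_fun \<alpha>)" and ?s = "s_const \<alpha>"
  have P_x: "P_fun \<alpha> (?x \<xi>) = \<xi>" for \<xi> using surj_P_fun[OF \<alpha>] by (rule surj_f_inv_f)
  have x_le: "?x \<xi> \<le> - c_const \<alpha> \<longleftrightarrow> \<xi> \<le> ?s" for \<xi>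
    using strict_mono_less_eq[OF strict_mono_P_fun[OF \<alpha>], of "?x \<xi>" "- c_const \<alpha>"]
    by (simp add: P_x s_const_def)
  have H_real: "H_inv \<alpha> (of_real \<xi>) = Complex (?x \<xi>) (v_fun \<alpha> (?x \<xi>))" for \<xi>
    using H_inv_of_real[OF \<alpha>] by (simp add: boundary_point_def[OF \<alpha>])
  \<comment> \<open>Up to \<open>s\<close> the inverse of \<open>H_fun\<close> is real, so the same formula covers both cases.\<close>
  have f_eq: "f \<xi> = - Im (1 / H_inv \<alpha> (of_real \<xi>)) / pi" for \<xi>
    using assms(3,4) x_le[of \<xi>] v_fun_zero[OF \<alpha>, of "?x \<xi>"] by (auto simp: H_real Im_divide)
  have f_pos: "f \<xi> > 0" if "\<xi> > ?s" for \<xi>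
  proof -
    have "v_fun \<alpha> (?x \<xi>) > 0" using v_fun_pos[OF \<alpha>] x_le[of \<xi>] that by simp
    hence "Q (?x \<xi>) > 0" using assms(3) by (auto intro!: divide_pos_pos add_nonneg_pos)
    thus ?thesis using assms(4) that by simp
  qed
  have f_zero: "f \<xi> = 0" if "\<xi> \<le> ?s" for \<xi> using assms(4) that by simp
  have g_cont: "continuous_on {z. Im z \<ge> 0} (\<lambda>z. 1 / H_inv \<alpha> z)"
    using continuous_on_H_inv[OF \<alpha>] H_inv_nonzero[OF \<alpha>] by (intro continuous_intros) auto
  have density: "\<nu> = density lborel (\<lambda>\<xi>. ennreal (f \<xi>))"
    unfolding f_eq
    by (rule stieltjes_inversion[OF \<nu> g_cont cauchy_transform_free_gamma_eq[OF \<alpha> \<nu> assms(2)]])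
  have "continuous_on UNIV f"
  proof -
    have "continuous_on UNIV (\<lambda>\<xi>. - Im (1 / H_inv \<alpha> (of_real \<xi>)) / pi)"
      by (intro continuous_intros continuous_on_compose2[OF g_cont]) auto
    thus ?thesis by (simp add: f_eq[abs_def])
  qed
  hence f_meas [measurable]: "f \<in> borel_measurable borel" by (rule borel_measurable_continuous_onI)
  have f_nonneg: "f \<xi> \<ge> 0" for \<xi> using f_pos[of \<xi>] f_zero[of \<xi>] by (cases "\<xi> \<le> ?s") auto

  have "absolutely_continuous lborel \<nu>"
    unfolding density by (intro absolutely_continuousI_density) auto
  moreover have "is_lebesgue_density \<nu> f"
    using density f_meas f_nonneg by (simp add: is_lebesgue_density_def)
  moreover have "measure_support \<nu> = {?s..}"
  proof (intro set_eqI iffI)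
    fix x assume x: "x \<in> measure_support \<nu>"
    have "emeasure \<nu> {..<?s} = 0"
    proof -
      have "emeasure \<nu> {..<?s} = (\<integral>\<^sup>+\<xi>. ennreal (f \<xi>) * indicator {..<?s} \<xi> \<partial>lborel)"
        unfolding density by (rule emeasure_density) auto
      also have "\<dots> = (\<integral>\<^sup>+\<xi>. 0 \<partial>(lborel :: real measure))"
        by (intro nn_integral_cong) (auto simp: indicator_def f_zero)
      finally show ?thesis by simp
    qed
    moreover have "open U \<and> x \<in> U \<Longrightarrow> 0 < emeasure \<nu> U" for U
      using x by (simp add: measure_support_def)
    from this[of "{..<?s}"] have "x < ?s \<Longrightarrow> 0 < emeasure \<nu> {..<?s}" by simp
    ultimately show "x \<in> {?s..}" by (cases "x < ?s") auto
  next
    fix x assume x: "x \<in> {?s..}"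
    show "x \<in> measure_support \<nu>"
      unfolding measure_support_def
    proof safe
      fix U assume U: "open U" "x \<in> U"
      then obtain e where e: "e > 0" "ball x e \<subseteq> U" using open_contains_ball by blast
      let ?I = "{x<..<x + e}"
      have "?I \<subseteq> U" using e(2) by (auto simp: dist_real_def subset_iff)
      have "emeasure \<nu> ?I \<noteq> 0"
      proof
        assume "emeasure \<nu> ?I = 0"
        hence "(\<integral>\<^sup>+\<xi>. ennreal (f \<xi>) * indicator ?I \<xi> \<partial>lborel) = 0"
          unfolding density by (subst (asm) emeasure_density) auto
        hence "AE \<xi> in lborel. ennreal (f \<xi>) * indicator ?I \<xi> = 0"
          by (subst (asm) nn_integral_0_iff_AE) auto
        hence "AE \<xi> in lborel. \<xi> \<notin> ?I"
        proof eventually_elim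
          case (elim \<xi>)
          show ?case
          proof
            assume "\<xi> \<in> ?I"
            hence "f \<xi> > 0" "f \<xi> \<le> 0" using elim x f_pos[of \<xi>] by (auto simp: ennreal_eq_0_iff)
            thus False by simp
          qed
        qed
        hence "?I \<in> null_sets lborel" by (subst AE_iff_null_sets) auto
        thus False using e(1) by (auto simp: null_sets_def)
      qed
      hence "0 < emeasure \<nu> ?I" by (simp add: zero_less_iff_neq_zero)
      also have "\<dots> \<le> emeasure \<nu> U"
        using U(1) \<open>?I \<subseteq> U\<close> by (intro emeasure_mono) (auto simp: density)
      finally show "0 < emeasure \<nu> U" .
    qed
  qed
  moreover have "real_analytic_on f {?s<..}"
    unfolding real_analytic_on_def
  proof
    fix \<xi> assume \<xi>: "\<xi> \<in> {?s<..}"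
    let ?w = "H_inv \<alpha> (of_real \<xi>)"
    have w: "?w \<in> upper_closure \<alpha>" "H_fun \<alpha> ?w = of_real \<xi>"
      by (simp_all add: H_inv_in[OF \<alpha>] H_fun_H_inv[OF \<alpha>])
    have "Im ?w > 0" using v_fun_pos[OF \<alpha>, of "?x \<xi>"] x_le[of \<xi>] \<xi> by (simp add: H_real)
    from H_inv_local_extension[OF \<alpha> w(1) this] obtain r g where r: "r > 0"
      and g: "g holomorphic_on ball (of_real \<xi>) r" "\<And>z. z \<in> ball (of_real \<xi>) r \<Longrightarrow> g z \<noteq> 0"
        "\<And>z. z \<in> ball (of_real \<xi>) r \<Longrightarrow> Im z \<ge> 0 \<Longrightarrow> g z = H_inv \<alpha> z"
      unfolding w(2) by blast
    \<comment> \<open>The imaginary parts of the Taylor coefficients of \<open>1 / g\<close> give the real power series.\<close>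
    define c where "c n = (deriv ^^ n) (\<lambda>z. 1 / g z) (of_real \<xi>) / fact n" for n
    have "(\<lambda>n. (- Im (c n) / pi) * (y - \<xi>) ^ n) sums f y" if y: "\<bar>y - \<xi>\<bar> < r" for y
    proof -
      have yb: "complex_of_real y \<in> ball (of_real \<xi>) r"
        using y by (simp add: dist_norm abs_minus_commute flip: of_real_diff)
      have "(\<lambda>z. 1 / g z) holomorphic_on ball (of_real \<xi>) r"
        using g by (intro holomorphic_intros) auto
      from holomorphic_power_series[OF this yb]
      have "(\<lambda>n. c n * (of_real y - of_real \<xi>) ^ n) sums (1 / g (of_real y))" by (simp add: c_def)
      hence "(\<lambda>n. - Im (c n * (of_real y - of_real \<xi>) ^ n) / pi) sums (- Im (1 / g (of_real y)) / pi)"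
        by (intro sums_divide sums_minus sums_Im)
      also have "(\<lambda>n. - Im (c n * (of_real y - of_real \<xi>) ^ n) / pi) = (\<lambda>n. (- Im (c n) / pi) * (y - \<xi>) ^ n)"
        by (simp flip: of_real_diff of_real_power)
      also have "- Im (1 / g (of_real y)) / pi = f y" using g(3)[OF yb] by (simp add: f_eq)
      finally show ?thesis .
    qed
    with r show "\<exists>r>0. \<exists>a. \<forall>y. \<bar>y - \<xi>\<bar> < r \<longrightarrow> (\<lambda>n. a n * (y - \<xi>) ^ n) sums f y"
      by (intro exI[of _ r] conjI exI[of _ "\<lambda>n. - Im (c n) / pi"] allI impI)
  qed
  ultimately show ?thesis by blast
qed

end
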